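(* To every pair $(L,u)$ consisting of an oriented spatial arc $L\subset\mathbf{R}^3$ and a unit vector $u\in S^2$ (equivalently, the projection $\lambda_u:\mathbf{R}^3\to P_u$ along $u$) one can assign an isomorphism class $D(L;u)$ of arc diagrams, depending only on $L$ and $u$, such that the following holds. For every oriented spatial arc $L$ in $\mathbf{R}^3$ and every unit vector $u\in S^2$ there is $\delta_0>0$ such that for every $\delta$ with $0<\delta<\delta_0$ the projection $\lambda_u$ has a $\delta$-approximation $\lambda_u^{\delta}=\lambda_{u'}$ (with $u'\in S^2$ and $\|u'-u\|<\delta$) whose projection image $\lambda_u^{\delta}(L)$ is an arc diagram belonging to the isomorphism class $D(L;u)$. In particular, the isomorphism class of the arc diagram $\lambda_u^\delta(L)$ does not depend on $\delta$.
   Context: A spatial arc is an (embedded) polygonal arc in $\mathbf{R}^3$; it is oriented from its starting point to its terminal point. $S^2=\{u\in\mathbf{R}^3 : \|u\|=1\}$ is the unit sphere. For $u\in S^2$, $P_u$ is the oriented plane through the origin having $u$ as positively normal vector, and $\lambda_u:\mathbf{R}^3\to P_u$ is the orthogonal projection, called the projection along $u$. For $\delta>0$, a $\delta$-approximation of $\lambda_u$ is a projection $\lambda_{u'}:\mathbf{R}^3\to P_{u'}$ along a unit vector $u'\in S^2$ with $\|u'-u\|<\delta$; it is denoted by $\lambda_u^{\delta}$. The projection image $\lambda_u(L)$ of a spatial arc $L$ is an arc diagram in the oriented plane $P_u$ if its only multiple points are crossing points, i.e. transversely meeting double points (equipped with the over-under information given by the heights in the direction $u$), and the images of the starting and terminal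 points of $L$ are single points. (Transversality means that each double point is a transverse intersection of the images of two open edges.) An arc diagram $(P,D)$ in an oriented plane $P$ is isomorphic to an arc diagram $(P',D')$ in an oriented plane $P'$ if there is an orientation-preserving homeomorphism $f:P\to P'$ sending $D$ to $D'$ and preserving the crossing points (with their over-under information), the starting points and the terminal points. *)

theory Defs
  imports "HOL-Complex_Analysis.Complex_Analysis"
begin

section \<open>Oriented spatial arcs\<close>

text \<open>
  The path that runs along the edges of the polygonal chain with the given list of vertices.
  For lists with fewer than two vertices it is constant, hence never an arc.
\<close>

fun polygonal_path :: "'a::real_normed_vector list \<Rightarrow> real \<Rightarrow> 'a" where
  "polygonal_path [] = linepath 0 0"
| "polygonal_path [a] = linepath a a"
| "polygonal_path [a, b] = linepath a b"
| "polygonal_path (a # b # c # vs) = linepath a b +++ polygonal_path (b # c # vs)"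

text \<open>
  An oriented arc is recorded as a point set with its starting point and its terminal point; the
  orientation is determined by the order of these two points. No vertex list is part of the
  data: anything that is a function of this record depends on the oriented arc only, and not
  on a subdivision of it into edges.
\<close>

record oriented_arc =
  support :: "(real^3) set"
  init_pt :: "real^3"
  term_pt :: "real^3"

definition vertex_list_of :: "(real^3) list \<Rightarrow> oriented_arc \<Rightarrow> bool" where
  "vertex_list_of vs L \<longleftrightarrow>
     arc (polygonal_path vs) \<and>
     path_image (polygonal_path vs) = support L \<and>
     pathstart (polygonal_path vs) = init_pt L \<and>
     pathfinish (polygonal_path vs) = term_pt L"

definition spatial_arc :: "oriented_arc \<Rightarrow> bool" where
  "spatial_arc L \<longleftrightarrow> (\<exists>vs. vertex_list_of vs L)"


section \<open>Projections and their multiple points\<close>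

text \<open>Here and below, \<open>u\<close> is meant to be a unit vector.\<close>

definition plane :: "real^3 \<Rightarrow> (real^3) set" where
  "plane u = {x. x \<bullet> u = 0}"

definition proj :: "real^3 \<Rightarrow> real^3 \<Rightarrow> real^3" where
  "proj u x = x - (x \<bullet> u) *\<^sub>R u"

definition delta_approximation :: "real \<Rightarrow> real^3 \<Rightarrow> real^3 \<Rightarrow> bool" where
  "delta_approximation \<delta> u u' \<longleftrightarrow> u' \<in> sphere 0 1 \<and> norm (u' - u) < \<delta>"

definition fibre :: "oriented_arc \<Rightarrow> real^3 \<Rightarrow> real^3 \<Rightarrow> (real^3) set" where
  "fibre L u p = {x \<in> support L. proj u x = p}"

definition multiple_points :: "oriented_arc \<Rightarrow> real^3 \<Rightarrow> (real^3) set" where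
  "multiple_points L u = {p. \<exists>x y. x \<in> fibre L u p \<and> y \<in> fibre L u p \<and> x \<noteq> y}"

text \<open>
  \<open>p\<close> is a double point of the projection, with one preimage in each of two open edges (relative to
  the vertex list \<open>vs\<close>) whose images have linearly independent directions.
\<close>

definition crossing_point :: "(real^3) list \<Rightarrow> oriented_arc \<Rightarrow> real^3 \<Rightarrow> real^3 \<Rightarrow> bool" where
  "crossing_point vs L u p \<longleftrightarrow>
     (\<exists>i j x y. Suc i < length vs \<and> Suc j < length vs \<and>
        x \<in> open_segment (vs ! i) (vs ! Suc i) \<and>
        y \<in> open_segment (vs ! j) (vs ! Suc j) \<and>
        x \<noteq> y \<and> fibre L u p = {x, y} \<and>
        \<not> collinear {0, proj u (vs ! Suc i - vs ! i), proj u (vs ! Suc j - vs ! j)})"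

text \<open>
  Superfluous vertices (between collinear edges) only make the condition on the edges stronger, so
  that the existential quantifier amounts to using the vertex list with the longest possible edges.
\<close>

definition projects_to_diagram :: "oriented_arc \<Rightarrow> real^3 \<Rightarrow> bool" where
  "projects_to_diagram L u \<longleftrightarrow>
     (\<exists>vs. vertex_list_of vs L \<and> (\<forall>p \<in> multiple_points L u. crossing_point vs L u p)) \<and>
     fibre L u (proj u (init_pt L)) = {init_pt L} \<and>
     fibre L u (proj u (term_pt L)) = {term_pt L}"


section \<open>Arc diagrams\<close>

text \<open>
  A diagram lies in the plane through the origin that is oriented by its unit normal vector. The
  over-under information assigns to each crossing point \<open>c\<close> the germ at \<open>c\<close> of the over-strand and
  the germ at \<open>c\<close> of the under-strand. Such a germ is given by a filter: a property holds eventually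
  with respect to it iff it holds at all points of the strand that are sufficiently close to \<open>c\<close>
  and different from \<open>c\<close>. The values of \<open>over_strand\<close> and \<open>under_strand\<close> at points
  that are not crossing points carry no information.
\<close>

record arc_diagram =
  normal_vec :: "real^3"
  diagram :: "(real^3) set"
  crossings :: "(real^3) set"
  over_strand :: "real^3 \<Rightarrow> (real^3) filter"
  under_strand :: "real^3 \<Rightarrow> (real^3) filter"
  start_pt :: "real^3"
  end_pt :: "real^3"

definition upper_point :: "oriented_arc \<Rightarrow> real^3 \<Rightarrow> real^3 \<Rightarrow> real^3" where
  "upper_point L u p = arg_max_on (\<lambda>x. x \<bullet> u) (fibre L u p)"

definition lower_point :: "oriented_arc \<Rightarrow> real^3 \<Rightarrow> real^3 \<Rightarrow> real^3" where
  "lower_point L u p = arg_min_on (\<lambda>x. x \<bullet> u) (fibre L u p)"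

definition projection_image :: "oriented_arc \<Rightarrow> real^3 \<Rightarrow> arc_diagram" where
  "projection_image L u =
     \<lparr> normal_vec = u,
       diagram = proj u ` support L,
       crossings = multiple_points L u,
       over_strand = (\<lambda>c. filtermap (proj u) (at (upper_point L u c) within support L)),
       under_strand = (\<lambda>c. filtermap (proj u) (at (lower_point L u c) within support L)),
       start_pt = proj u (init_pt L),
       end_pt = proj u (term_pt L) \<rparr>"

definition arc_diagrams :: "arc_diagram set" where
  "arc_diagrams =
     {projection_image L u | L u. spatial_arc L \<and> u \<in> sphere 0 1 \<and> projects_to_diagram L u}"


section \<open>Isomorphism of arc diagrams\<close>

text \<open>
  \<open>(e1, e2)\<close> is a positively oriented orthonormal basis of the oriented plane \<open>plane u\<close>; it
  identifies this plane with the complex numbers.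
\<close>

definition positive_frame :: "real^3 \<Rightarrow> real^3 \<Rightarrow> real^3 \<Rightarrow> bool" where
  "positive_frame u e1 e2 \<longleftrightarrow>
     norm e1 = 1 \<and> norm e2 = 1 \<and> e1 \<bullet> e2 = 0 \<and> cross3 e1 e2 = u"

definition frame_coord :: "real^3 \<Rightarrow> real^3 \<Rightarrow> real^3 \<Rightarrow> complex" where
  "frame_coord e1 e2 x = Complex (x \<bullet> e1) (x \<bullet> e2)"

text \<open>
  A homeomorphism between oriented planes preserves the orientation iff it respects
  the local orientation at every point \<open>z\<close>, i.e. iff it carries the positive generator of the
  fundamental group of the punctured plane at \<open>z\<close> to the positive generator at the image point.
  This means that it preserves all winding numbers of loops around \<open>z\<close>.
\<close>

definition orientation_preserving_map ::
  "real^3 \<Rightarrow> real^3 \<Rightarrow> (real^3 \<Rightarrow> real^3) \<Rightarrow> bool" where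
  "orientation_preserving_map u u' f \<longleftrightarrow>
     (\<forall>e1 e2 e1' e2' z \<gamma>.
        positive_frame u e1 e2 \<and> positive_frame u' e1' e2' \<and> z \<in> plane u \<and>
        path \<gamma> \<and> pathfinish \<gamma> = pathstart \<gamma> \<and> path_image \<gamma> \<subseteq> plane u - {z} \<longrightarrow>
        winding_number (frame_coord e1' e2' \<circ> f \<circ> \<gamma>) (frame_coord e1' e2' (f z)) =
        winding_number (frame_coord e1 e2 \<circ> \<gamma>) (frame_coord e1 e2 z))"

definition diagram_isomorphism ::
  "arc_diagram \<Rightarrow> arc_diagram \<Rightarrow> (real^3 \<Rightarrow> real^3) \<Rightarrow> bool" where
  "diagram_isomorphism d d' f \<longleftrightarrow>
     (\<exists>g. homeomorphism (plane (normal_vec d)) (plane (normal_vec d')) f g) \<and>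
     orientation_preserving_map (normal_vec d) (normal_vec d') f \<and>
     f ` diagram d = diagram d' \<and>
     f ` crossings d = crossings d' \<and>
     (\<forall>c \<in> crossings d.
        filtermap f (over_strand d c) = over_strand d' (f c) \<and>
        filtermap f (under_strand d c) = under_strand d' (f c)) \<and>
     f (start_pt d) = start_pt d' \<and>
     f (end_pt d) = end_pt d'"

definition isomorphic_diagrams :: "(arc_diagram \<times> arc_diagram) set" where
  "isomorphic_diagrams =
     {(d, d'). d \<in> arc_diagrams \<and> d' \<in> arc_diagrams \<and> (\<exists>f. diagram_isomorphism d d' f)}"


section \<open>Isomorphism is an equivalence relation\<close>

lemma positive_frame_exists:
  assumes "u \<in> sphere 0 1"
  shows "\<exists>e1 e2. positive_frame u e1 e2"
proof -
  obtain y where y: "y \<noteq> 0" "orthogonal u y" using orthogonal_to_vector_exists[of u] by auto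
  define e where "e = y /\<^sub>R norm y"
  have e: "norm e = 1" "u \<bullet> e = 0" using y by (auto simp: e_def orthogonal_def)
  have u: "norm u = 1" using assms by simp
  have n: "norm (cross3 u e) = 1" using norm_cross_dot[of u e] e u by (simp add: power2_eq_1_iff) (smt (verit) norm_ge_zero)
  have "cross3 e (cross3 u e) = (e \<bullet> e) *\<^sub>R u - (e \<bullet> u) *\<^sub>R e"
    by (rule Lagrange)
  then have "cross3 e (cross3 u e) = u" using e by (simp add: inner_commute norm_eq_1)
  then have "positive_frame u e (cross3 u e)"
    using e n by (simp add: positive_frame_def dot_cross_self)
  then show ?thesis by blast
qed

lemma winding_number_rotate:
  assumes "path p" "pathfinish p = pathstart p" "z \<notin> path_image p" "norm c = 1"
  shows "winding_number (\<lambda>t. c * p t) (c * z) = winding_number p z"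
proof -
  obtain \<theta> where c: "c = cis \<theta>" using assms(4) by (metis complex_norm_eq_1_exp cis_conv_exp)
  have cp: "continuous_on {0..1} p" using assms(1) by (simp add: path_def)
  have "homotopic_loops (- {0}) (\<lambda>t. p t - z) (\<lambda>t. c * p t - c * z)"
    unfolding homotopic_loops
  proof (intro exI conjI ballI)
    let ?h = "\<lambda>x::real\<times>real. cis (fst x * \<theta>) * (p (snd x) - z)"
    show "continuous_on ({0..1} \<times> {0..1}) ?h"
      by (intro continuous_intros continuous_on_compose2[OF cp]) auto
    show "?h \<in> {0..1} \<times> {0..1} \<rightarrow> - {0}"
      using assms(3) by (auto simp: path_image_def)
    show "pathfinish (?h \<circ> Pair t) = pathstart (?h \<circ> Pair t)" for t
      using assms(2) by (simp add: pathfinish_def pathstart_def)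
  qed (auto simp: c algebra_simps)
  then have "winding_number (\<lambda>t. p t - z) 0 = winding_number (\<lambda>t. c * p t - c * z) 0"
    by (rule winding_number_homotopic_loops)
  then show ?thesis
    using winding_number_offset[of p z] winding_number_offset[of "\<lambda>t. c * p t" "c * z"] by simp
qed

lemma plane_eqI:
  assumes f: "positive_frame u e1 e2" and x: "x \<in> plane u"
  shows "x = (x \<bullet> e1) *\<^sub>R e1 + (x \<bullet> e2) *\<^sub>R e2"
proof -
  define y where "y = x - ((x \<bullet> e1) *\<^sub>R e1 + (x \<bullet> e2) *\<^sub>R e2)"
  have e: "e1 \<bullet> e1 = 1" "e2 \<bullet> e2 = 1" "e1 \<bullet> e2 = 0" "e2 \<bullet> e1 = 0" "cross3 e1 e2 = u"
    using f by (auto simp: positive_frame_def norm_eq_1 inner_commute)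
  have y: "y \<bullet> e1 = 0" "y \<bullet> e2 = 0"
    using e by (simp_all add: y_def inner_diff_left inner_add_left)
  have "e1 \<bullet> u = 0" "e2 \<bullet> u = 0"
    using e(5) dot_cross_self by metis+
  then have yu: "y \<bullet> u = 0"
    using x by (simp add: y_def plane_def inner_diff_left inner_add_left)
  have "cross3 y u = (y \<bullet> e2) *\<^sub>R e1 - (y \<bullet> e1) *\<^sub>R e2"
    using Lagrange e(5) by metis
  then have "cross3 y u = 0" using y by simp
  then have "y = 0 \<or> u = 0" using yu norm_and_cross_eq_0 by blast
  moreover have "norm u = 1" using norm_cross_dot[of e1 e2] f by (auto simp: positive_frame_def power2_eq_1_iff) (smt (verit) norm_ge_zero)
  ultimately show ?thesis by (auto simp: y_def)
qed

lemma frame_coord_change: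
  assumes "positive_frame u e1 e2" "positive_frame u e1' e2'"
  shows "\<exists>c. norm c = 1 \<and> (\<forall>x \<in> plane u. frame_coord e1' e2' x = c * frame_coord e1 e2 x)"
proof -
  have e: "e1 \<bullet> e1 = 1" "e2 \<bullet> e2 = 1" "e1 \<bullet> e2 = 0" "e2 \<bullet> e1 = 0" "cross3 e1 e2 = u"
    using assms by (auto simp: positive_frame_def norm_eq_1 inner_commute)
  have e': "e1' \<bullet> e1' = 1" "e2' \<bullet> e2' = 1" "e1' \<bullet> e2' = 0" "e2' \<bullet> e1' = 0" "cross3 e1' e2' = u"
    using assms by (auto simp: positive_frame_def norm_eq_1 inner_commute)
  have pl: "e1' \<in> plane u" "e2' \<in> plane u" "e1 \<in> plane u" "e2 \<in> plane u"
    unfolding plane_def mem_Collect_eq using e(5) e'(5) dot_cross_self by metis+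
  have u2: "cross3 u e1' = e2'"
    using Lagrange[of e1' e1' e2'] e' cross_skew[of u e1'] by simp
  have u1: "cross3 u e1 = e2" "cross3 u e2 = - e1"
    using Lagrange[of e1 e1 e2] Lagrange[of e2 e1 e2] e cross_skew[of u e1] cross_skew[of u e2] by simp_all
  define a b where "a = e1' \<bullet> e1" and "b = e1' \<bullet> e2"
  have e1': "e1' = a *\<^sub>R e1 + b *\<^sub>R e2"
    unfolding a_def b_def by (rule plane_eqI[OF assms(1) pl(1)])
  have "e2' = cross3 u (a *\<^sub>R e1 + b *\<^sub>R e2)" using u2 e1' by simp
  then have e2': "e2' = a *\<^sub>R e2 - b *\<^sub>R e1"
    using u1 by (simp add: cross_add_right cross_mult_right)
  have "(a *\<^sub>R e1 + b *\<^sub>R e2) \<bullet> (a *\<^sub>R e1 + b *\<^sub>R e2) = 1" using e'(1) e1' by simp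
  then have ab: "a * a + b * b = 1"
    using e by (simp add: inner_add_left inner_add_right)
  show ?thesis
  proof (intro exI conjI ballI)
    show "norm (Complex a (- b)) = 1" using ab by (simp add: complex_norm power2_eq_square)
    show "frame_coord e1' e2' x = Complex a (- b) * frame_coord e1 e2 x" for x
      unfolding frame_coord_def e1' e2'
      by (simp add: complex_eq_iff inner_add_right inner_diff_right algebra_simps)
  qed
qed

lemma winding_number_frame_coord:
  assumes f: "positive_frame u e1 e2" "positive_frame u e1' e2'"
    and z: "z \<in> plane u" and g: "path \<gamma>" "pathfinish \<gamma> = pathstart \<gamma>" "path_image \<gamma> \<subseteq> plane u - {z}"
  shows "winding_number (frame_coord e1' e2' \<circ> \<gamma>) (frame_coord e1' e2' z) =
         winding_number (frame_coord e1 e2 \<circ> \<gamma>) (frame_coord e1 e2 z)"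
proof -
  obtain c where c: "norm c = 1" "\<And>x. x \<in> plane u \<Longrightarrow> frame_coord e1' e2' x = c * frame_coord e1 e2 x"
    using frame_coord_change[OF f] by blast
  have inj: "frame_coord e1 e2 x \<noteq> frame_coord e1 e2 z" if "x \<in> plane u" "x \<noteq> z" for x
    using that plane_eqI[OF f(1) that(1)] plane_eqI[OF f(1) z]
    by (metis complex.inject frame_coord_def)
  have cont: "continuous_on UNIV (frame_coord e1 e2)"
    unfolding frame_coord_def Complex_eq by (intro continuous_intros)
  have p: "path (frame_coord e1 e2 \<circ> \<gamma>)"
    using g(1) cont by (metis path_continuous_image continuous_on_subset subset_UNIV)
  have cl: "pathfinish (frame_coord e1 e2 \<circ> \<gamma>) = pathstart (frame_coord e1 e2 \<circ> \<gamma>)"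
    using g(2) by (simp add: pathfinish_def pathstart_def)
  have zn: "frame_coord e1 e2 z \<notin> path_image (frame_coord e1 e2 \<circ> \<gamma>)"
    using g(3) inj by (fastforce simp: path_image_def)
  have "winding_number (frame_coord e1' e2' \<circ> \<gamma>) (frame_coord e1' e2' z) =
        winding_number (\<lambda>t. c * (frame_coord e1 e2 \<circ> \<gamma>) t) (c * frame_coord e1 e2 z)"
    unfolding c(2)[OF z]
  proof (rule winding_number_cong)
    show "(frame_coord e1' e2' \<circ> \<gamma>) t = c * (frame_coord e1 e2 \<circ> \<gamma>) t" if "0 \<le> t" "t \<le> 1" for t
      using g(3) that c(2)[of "\<gamma> t"] by (force simp: path_image_def)
  qed
  also have "\<dots> = winding_number (frame_coord e1 e2 \<circ> \<gamma>) (frame_coord e1 e2 z)"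
    by (rule winding_number_rotate[OF p cl zn c(1)])
  finally show ?thesis .
qed

lemma orientation_preserving_map_id: "orientation_preserving_map u u (\<lambda>x. x)"
  unfolding orientation_preserving_map_def
proof (intro allI impI, elim conjE)
  fix e1 e2 e1' e2' z and \<gamma> :: "real \<Rightarrow> real^3"
  assume "positive_frame u e1 e2" "positive_frame u e1' e2'" "z \<in> plane u" "path \<gamma>"
    "pathfinish \<gamma> = pathstart \<gamma>" "path_image \<gamma> \<subseteq> plane u - {z}"
  from winding_number_frame_coord[OF this]
  show "winding_number (frame_coord e1' e2' \<circ> (\<lambda>x. x) \<circ> \<gamma>) (frame_coord e1' e2' z) =
        winding_number (frame_coord e1 e2 \<circ> \<gamma>) (frame_coord e1 e2 z)"
    by (simp add: o_def)
qed

lemma loop_image_homeomorphism: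
  assumes h: "homeomorphism (plane u) (plane u') f g" and z: "z \<in> plane u"
    and l: "path \<gamma>" "pathfinish \<gamma> = pathstart \<gamma>" "path_image \<gamma> \<subseteq> plane u - {z}"
  shows "path (f \<circ> \<gamma>)" "pathfinish (f \<circ> \<gamma>) = pathstart (f \<circ> \<gamma>)"
    "path_image (f \<circ> \<gamma>) \<subseteq> plane u' - {f z}" "f z \<in> plane u'"
proof -
  have "continuous_on (path_image \<gamma>) f"
    using h l(3) by (auto simp: homeomorphism_def intro: continuous_on_subset)
  then show "path (f \<circ> \<gamma>)" using l(1) by (rule path_continuous_image[rotated])
  show "pathfinish (f \<circ> \<gamma>) = pathstart (f \<circ> \<gamma>)"
    using l(2) by (simp add: pathfinish_def pathstart_def)
  have "f x \<in> plane u'" "g (f x) = x" if "x \<in> plane u" for x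
    using h that by (auto simp: homeomorphism_def)
  note fx = this
  show "f z \<in> plane u'" by (rule fx(1)[OF z])
  show "path_image (f \<circ> \<gamma>) \<subseteq> plane u' - {f z}"
  proof
    fix y assume "y \<in> path_image (f \<circ> \<gamma>)"
    then obtain x where x: "x \<in> path_image \<gamma>" "y = f x" by (auto simp: path_image_compose)
    then have "x \<in> plane u" "x \<noteq> z" using l(3) by auto
    moreover from this have "f x \<noteq> f z" using fx(2)[of x] fx(2)[OF z] by metis
    ultimately show "y \<in> plane u' - {f z}" using fx(1)[of x] x(2) by simp
  qed
qed

lemma orientation_preserving_map_comp:
  assumes h: "homeomorphism (plane u) (plane u') f g" and u': "u' \<in> sphere 0 1"
    and f: "orientation_preserving_map u u' f" and f': "orientation_preserving_map u' u'' f'"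
  shows "orientation_preserving_map u u'' (f' \<circ> f)"
  unfolding orientation_preserving_map_def
proof (intro allI impI, elim conjE)
  fix e1 e2 e1'' e2'' z and \<gamma> :: "real \<Rightarrow> real^3"
  assume e: "positive_frame u e1 e2" and e'': "positive_frame u'' e1'' e2''" and z: "z \<in> plane u"
    and l: "path \<gamma>" "pathfinish \<gamma> = pathstart \<gamma>" "path_image \<gamma> \<subseteq> plane u - {z}"
  obtain e1' e2' where e': "positive_frame u' e1' e2'" using positive_frame_exists[OF u'] by blast
  note L = loop_image_homeomorphism[OF h z l]
  have "winding_number (frame_coord e1'' e2'' \<circ> f' \<circ> (f \<circ> \<gamma>)) (frame_coord e1'' e2'' (f' (f z))) =
        winding_number (frame_coord e1' e2' \<circ> (f \<circ> \<gamma>)) (frame_coord e1' e2' (f z))"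
    using f' e' e'' L unfolding orientation_preserving_map_def by blast
  also have "\<dots> = winding_number (frame_coord e1' e2' \<circ> f \<circ> \<gamma>) (frame_coord e1' e2' (f z))"
    by (simp add: o_assoc)
  also have "\<dots> = winding_number (frame_coord e1 e2 \<circ> \<gamma>) (frame_coord e1 e2 z)"
    using f e e' z l unfolding orientation_preserving_map_def by blast
  finally show "winding_number (frame_coord e1'' e2'' \<circ> (f' \<circ> f) \<circ> \<gamma>) (frame_coord e1'' e2'' ((f' \<circ> f) z)) =
        winding_number (frame_coord e1 e2 \<circ> \<gamma>) (frame_coord e1 e2 z)"
    by (simp add: o_assoc)
qed

lemma orientation_preserving_map_inverse:
  assumes h: "homeomorphism (plane u) (plane u') f g"
    and f: "orientation_preserving_map u u' f"
  shows "orientation_preserving_map u' u g"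
  unfolding orientation_preserving_map_def
proof (intro allI impI, elim conjE)
  fix e1' e2' e1 e2 z and \<gamma> :: "real \<Rightarrow> real^3"
  assume e': "positive_frame u' e1' e2'" and e: "positive_frame u e1 e2" and z: "z \<in> plane u'"
    and l: "path \<gamma>" "pathfinish \<gamma> = pathstart \<gamma>" "path_image \<gamma> \<subseteq> plane u' - {z}"
  have hg: "homeomorphism (plane u') (plane u) g f" using h by (rule homeomorphism_symD)
  note L = loop_image_homeomorphism[OF hg z l]
  have fg: "f (g x) = x" if "x \<in> plane u'" for x using h that by (auto simp: homeomorphism_def)
  have "winding_number (frame_coord e1 e2 \<circ> (g \<circ> \<gamma>)) (frame_coord e1 e2 (g z)) =
        winding_number (frame_coord e1' e2' \<circ> f \<circ> (g \<circ> \<gamma>)) (frame_coord e1' e2' (f (g z)))"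
    using f e e' L unfolding orientation_preserving_map_def by metis
  also have "\<dots> = winding_number (frame_coord e1' e2' \<circ> \<gamma>) (frame_coord e1' e2' z)"
    unfolding fg[OF z]
  proof (rule winding_number_cong)
    show "(frame_coord e1' e2' \<circ> f \<circ> (g \<circ> \<gamma>)) t = (frame_coord e1' e2' \<circ> \<gamma>) t"
      if "0 \<le> t" "t \<le> 1" for t
      using fg[of "\<gamma> t"] l(3) that by (force simp: path_image_def)
  qed
  finally show "winding_number (frame_coord e1 e2 \<circ> g \<circ> \<gamma>) (frame_coord e1 e2 (g z)) =
        winding_number (frame_coord e1' e2' \<circ> \<gamma>) (frame_coord e1' e2' z)"
    by (simp add: o_assoc)
qed

lemma arc_diagrams_in_plane:
  assumes "d \<in> arc_diagrams"
  shows "normal_vec d \<in> sphere 0 1" "diagram d \<subseteq> plane (normal_vec d)"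
    "crossings d \<subseteq> plane (normal_vec d)"
    "start_pt d \<in> plane (normal_vec d)" "end_pt d \<in> plane (normal_vec d)"
    "\<forall>\<^sub>F x in over_strand d c. x \<in> plane (normal_vec d)"
    "\<forall>\<^sub>F x in under_strand d c. x \<in> plane (normal_vec d)"
proof -
  obtain L u where d: "d = projection_image L u" and u: "u \<in> sphere 0 1"
    using assms by (auto simp: arc_diagrams_def)
  have "u \<bullet> u = 1" using u by (simp add: norm_eq_1)
  then have p: "proj u x \<in> plane u" for x
    by (simp add: proj_def plane_def inner_diff_left)
  show "normal_vec d \<in> sphere 0 1" "diagram d \<subseteq> plane (normal_vec d)"
    "crossings d \<subseteq> plane (normal_vec d)"
    "start_pt d \<in> plane (normal_vec d)" "end_pt d \<in> plane (normal_vec d)"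
    "\<forall>\<^sub>F x in over_strand d c. x \<in> plane (normal_vec d)"
    "\<forall>\<^sub>F x in under_strand d c. x \<in> plane (normal_vec d)"
    using p u by (simp_all add: d projection_image_def multiple_points_def fibre_def eventually_filtermap) auto
qed

lemma diagram_isomorphism_id: "diagram_isomorphism d d (\<lambda>x. x)"
  unfolding diagram_isomorphism_def
  using orientation_preserving_map_id homeomorphism_ident by auto

lemma diagram_isomorphism_comp:
  assumes d': "d' \<in> arc_diagrams"
    and f: "diagram_isomorphism d d' f" and f': "diagram_isomorphism d' d'' f'"
  shows "diagram_isomorphism d d'' (f' \<circ> f)"
proof -
  obtain g where g: "homeomorphism (plane (normal_vec d)) (plane (normal_vec d')) f g"
    using f by (auto simp: diagram_isomorphism_def)
  obtain g' where g': "homeomorphism (plane (normal_vec d')) (plane (normal_vec d'')) f' g'"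
    using f' by (auto simp: diagram_isomorphism_def)
  have "orientation_preserving_map (normal_vec d) (normal_vec d'') (f' \<circ> f)"
    using orientation_preserving_map_comp[OF g arc_diagrams_in_plane(1)[OF d']] f f'
    by (auto simp: diagram_isomorphism_def)
  moreover have "filtermap (f' \<circ> f) F = filtermap f' (filtermap f F)" for F
    by (simp add: filtermap_filtermap o_def)
  ultimately show ?thesis
    using f f' homeomorphism_compose[OF g g'] unfolding diagram_isomorphism_def image_comp[symmetric]
    by auto
qed

lemma filtermap_inverse:
  assumes "\<forall>\<^sub>F x in F. g (f x) = x" "filtermap f F = G"
  shows "filtermap g G = F"
proof (rule filter_eqI)
  fix P
  have "(\<forall>\<^sub>F x in F. P (g (f x))) \<longleftrightarrow> (\<forall>\<^sub>F x in F. P x)"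
    by (rule eventually_cong[OF assms(1)]) simp
  then show "eventually P (filtermap g G) \<longleftrightarrow> eventually P F"
    by (simp add: eventually_filtermap flip: assms(2))
qed

lemma diagram_isomorphism_inverse:
  assumes d: "d \<in> arc_diagrams" and f: "diagram_isomorphism d d' f"
  shows "\<exists>g. diagram_isomorphism d' d g"
proof -
  let ?P = "plane (normal_vec d)"
  obtain g where h: "homeomorphism ?P (plane (normal_vec d')) f g"
    using f by (auto simp: diagram_isomorphism_def)
  have gf: "g (f x) = x" if "x \<in> ?P" for x using h that by (auto simp: homeomorphism_def)
  have im: "g ` f ` S = S" if "S \<subseteq> ?P" for S
    using gf that by (force simp: image_comp)
  have f': "f ` diagram d = diagram d'" "f ` crossings d = crossings d'"
    "f (start_pt d) = start_pt d'" "f (end_pt d) = end_pt d'"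
    "\<And>c. c \<in> crossings d \<Longrightarrow> filtermap f (over_strand d c) = over_strand d' (f c)"
    "\<And>c. c \<in> crossings d \<Longrightarrow> filtermap f (under_strand d c) = under_strand d' (f c)"
    using f unfolding diagram_isomorphism_def by simp_all
  note D = arc_diagrams_in_plane[OF d]
  have ev: "\<forall>\<^sub>F x in over_strand d c. g (f x) = x" "\<forall>\<^sub>F x in under_strand d c. g (f x) = x" for c
    using D(6,7)[of c] gf by (auto elim: eventually_mono)
  have st: "filtermap g (over_strand d' c') = over_strand d (g c')"
       "filtermap g (under_strand d' c') = under_strand d (g c')" if "c' \<in> crossings d'" for c'
  proof -
    have "c' \<in> f ` crossings d" using that by (simp only: f'(2))
    then obtain c where c: "c \<in> crossings d" "c' = f c" by (rule imageE)
    have gc: "g (f c) = c" by (rule gf[OF subsetD[OF D(3) c(1)]])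
    show "filtermap g (over_strand d' c') = over_strand d (g c')"
      unfolding c(2) gc using filtermap_inverse[OF ev(1) f'(5)[OF c(1)]] .
    show "filtermap g (under_strand d' c') = under_strand d (g c')"
      unfolding c(2) gc using filtermap_inverse[OF ev(2) f'(6)[OF c(1)]] .
  qed
  have img: "g ` diagram d' = diagram d" "g ` crossings d' = crossings d"
    using im[OF D(2)] im[OF D(3)] by (simp_all add: f')
  have pts: "g (start_pt d') = start_pt d" "g (end_pt d') = end_pt d"
    using gf[OF D(4)] gf[OF D(5)] by (simp_all add: f')
  have hg: "homeomorphism (plane (normal_vec d')) ?P g f"
    using h by (rule homeomorphism_symD)
  have og: "orientation_preserving_map (normal_vec d') (normal_vec d) g"
    using orientation_preserving_map_inverse[OF h] f by (auto simp: diagram_isomorphism_def)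
  show ?thesis
    unfolding diagram_isomorphism_def
    by (rule exI[of _ g], intro conjI ballI exI[of _ f], rule hg, rule og, rule img(1), rule img(2),
        erule st(1), erule st(2), rule pts(1), rule pts(2))
qed

lemma equiv_isomorphic_diagrams: "equiv arc_diagrams isomorphic_diagrams"
proof (rule equivI)
  show "isomorphic_diagrams \<subseteq> arc_diagrams \<times> arc_diagrams"
    by (auto simp: isomorphic_diagrams_def)
  show "refl_on arc_diagrams isomorphic_diagrams"
    using diagram_isomorphism_id by (auto simp: isomorphic_diagrams_def refl_on_def)
  show "sym isomorphic_diagrams"
    using diagram_isomorphism_inverse by (auto simp: isomorphic_diagrams_def sym_def)
  show "trans isomorphic_diagrams"
    unfolding isomorphic_diagrams_def trans_def using diagram_isomorphism_comp by blast
qed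

end

theory Submission
  imports Defs
begin

text \<open>
  The class \<open>D(L;u)\<close> is the class of the diagrams that are seen from \<open>u + t d\<close>, rescaled to unit
  length, for all small \<open>t > 0\<close> and a suitable vector \<open>d\<close>. Two facts make this work.

  Genericity. The directions in which the projection of \<open>L\<close> is not a diagram annihilate one of finitely
  many non-zero polynomials in the direction, formed from the vertices of \<open>L\<close>: an edge is parallel
  to the direction, a vertex is seen on another edge, two edges are seen as parallel, or three edges
  are seen through a common point (\<open>generic_imp_regular\<close>). A point where none of the polynomials vanishes
  determines a line through \<open>u\<close> along which each of them has only finitely many zeros, so all directions
  \<open>u + t d\<close> with small \<open>t > 0\<close> are generic (\<open>nonzero_on_segment\<close>), although \<open>u\<close> itself may be degenerate.

  Stability. If \<open>u\<^sub>0\<close> is regular, the diagrams in all regular directions close to \<open>u\<^sub>0\<close> are isomorphic to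
  the diagram in the direction \<open>u\<^sub>0\<close> (\<open>eventually_isomorphic\<close>). Hence the class is locally constant on the
  regular directions and constant on the connected set of directions found above
  (\<open>isomorphic_on_connected\<close>, \<open>stable_approximations\<close>).

  The isomorphism that stability asks for is found in the form \<open>v \<mapsto> v + h v\<close> in coordinates of
  the two planes, where \<open>h\<close> has Lipschitz constant \<open>1/2\<close>. Such a map is always a homeomorphism of the plane,
  by Banach's fixed point theorem, and it preserves orientation because \<open>v \<mapsto> v + s h v\<close> deforms it to
  the identity. So \<open>h\<close> has only to satisfy two incidence conditions: the image of a vertex goes to the
  new image of this vertex, and the image of an edge goes into the line that carries the new image of
  this edge. The rest follows. By injectivity, edge images go onto edge images (\<open>edge_image\<close>), and
  crossings, being the coincidences of two edges, go to crossings (\<open>crossings_image\<close>). Which strand is the upper one is determined by the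
  signs of the triple products of the two edge directions with the vector between the edges, which is
  constant, and with the projection direction, which is nearly constant (\<open>height_sign\<close>).

  The incidence conditions are convex in the image point. Therefore solutions near single points can
  be blended with bump functions, and finitely many of them suffice by compactness
  (\<open>small_perturbation_local_to_global\<close>). Near a single point an affine solution can be written down: it
  lifts the plane to space along the edges in question and projects again, and at a crossing it adds a
  translation along one of the two edges (\<open>local_perturbation\<close>).
\<close>


section \<open>Small perturbations of the identity\<close>

text \<open>
  A single parameter controls the Lipschitz constant and, through the value at the origin, the size on
  every bounded set. The second bound is what makes cutting off with a bump function harmless.
\<close>

definition small_perturbation :: "real \<Rightarrow> ('a::real_normed_vector \<Rightarrow> 'a) \<Rightarrow> bool" where
  "small_perturbation \<epsilon> h \<longleftrightarrow> norm (h 0) \<le> \<epsilon> \<and> (\<forall>v w. norm (h v - h w) \<le> \<epsilon> * norm (v - w))"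

lemma small_perturbation_norm_le:
  assumes "small_perturbation \<epsilon> h"
  shows "norm (h v) \<le> \<epsilon> * (1 + norm v)"
proof -
  have "norm (h v - h 0) \<le> \<epsilon> * norm (v - 0)" "norm (h 0) \<le> \<epsilon>"
    using assms unfolding small_perturbation_def by blast+
  then show ?thesis using norm_triangle_sub[of "h v" "h 0"] by (simp add: algebra_simps)
qed

definition bump :: "'a::real_normed_vector \<Rightarrow> real \<Rightarrow> 'a \<Rightarrow> real" where
  "bump z r v = max 0 (min 1 (2 - 2 * norm (v - z) / r))"

lemma bump_bounds: "0 \<le> bump z r v" "bump z r v \<le> 1"
  by (auto simp: bump_def)

lemma bump_eq_0: "0 < r \<Longrightarrow> v \<notin> ball z r \<Longrightarrow> bump z r v = 0"
  by (simp add: bump_def dist_norm norm_minus_commute field_simps)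

lemma bump_eq_1: "0 < r \<Longrightarrow> v \<in> ball z (r / 2) \<Longrightarrow> bump z r v = 1"
  by (simp add: bump_def dist_norm norm_minus_commute field_simps)

lemma bump_Lipschitz:
  assumes "0 < r"
  shows "\<bar>bump z r v - bump z r w\<bar> \<le> 2 / r * norm (v - w)"
proof -
  have "\<bar>norm (v - z) - norm (w - z)\<bar> \<le> norm (v - w)"
    using norm_triangle_ineq3[of "v - z" "w - z"] by simp
  then have "2 / r * \<bar>norm (v - z) - norm (w - z)\<bar> \<le> 2 / r * norm (v - w)"
    using assms by (intro mult_left_mono) auto
  moreover have "(2 - 2 * norm (v - z) / r) - (2 - 2 * norm (w - z) / r)
      = - (2 / r * (norm (v - z) - norm (w - z)))"
    by (simp add: algebra_simps)
  then have "\<bar>(2 - 2 * norm (v - z) / r) - (2 - 2 * norm (w - z) / r)\<bar>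
      = 2 / r * \<bar>norm (v - z) - norm (w - z)\<bar>"
    by (simp only: abs_minus abs_mult) (use assms in simp)
  ultimately have "\<bar>(2 - 2 * norm (v - z) / r) - (2 - 2 * norm (w - z) / r)\<bar>
      \<le> 2 / r * norm (v - w)" by simp
  then show ?thesis unfolding bump_def by linarith
qed

text \<open>
  The difference of the two perturbations is bounded on the support of the bump function, so the product
  rule bounds the Lipschitz constant of the blend by a multiple of \<open>\<epsilon>\<close> that depends on the ball only.
\<close>

lemma small_perturbation_blend:
  assumes r: "0 < r" and \<epsilon>: "0 \<le> \<epsilon>"
    and h: "small_perturbation \<epsilon> h1" "small_perturbation \<epsilon> h2"
  shows "small_perturbation (\<epsilon> * (3 + 4 / r * (1 + norm z + r)))
           (\<lambda>v. h1 v + bump z r v *\<^sub>R (h2 v - h1 v))"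
proof -
  let ?b = "bump z r" let ?H = "\<lambda>v. h2 v - h1 v"
  let ?K = "3 + 4 / r * (1 + norm z + r)"
  have K: "1 \<le> ?K" using r by (simp add: add_increasing2)
  have Hl: "norm (?H v - ?H w) \<le> 2 * \<epsilon> * norm (v - w)" for v w
  proof -
    have "norm (h1 v - h1 w) \<le> \<epsilon> * norm (v - w)" "norm (h2 v - h2 w) \<le> \<epsilon> * norm (v - w)"
      using h unfolding small_perturbation_def by blast+
    moreover have "?H v - ?H w = (h2 v - h2 w) - (h1 v - h1 w)" by simp
    ultimately show ?thesis
      using norm_triangle_ineq4[of "h2 v - h2 w" "h1 v - h1 w"] by (simp only: mult.assoc)
  qed
  have Hb: "norm (?H v) \<le> 2 * \<epsilon> * (1 + norm z + r)" if "v \<in> ball z r" for v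
  proof -
    have "norm v \<le> norm z + r"
      using that norm_triangle_sub[of v z] by (simp add: dist_norm norm_minus_commute)
    then have "\<epsilon> * (1 + norm v) \<le> \<epsilon> * (1 + norm z + r)" using \<epsilon> by (simp add: mult_left_mono)
    then show ?thesis
      using small_perturbation_norm_le[OF h(1), of v] small_perturbation_norm_le[OF h(2), of v]
        norm_triangle_ineq4[of "h2 v" "h1 v"] by simp
  qed
  have lipschitz_sum: "2 / r * n * (2 * \<epsilon> * X) + 1 * (2 * \<epsilon> * n) = \<epsilon> * (2 + 4 / r * X) * n"
    "\<epsilon> * n + \<epsilon> * (2 + 4 / r * X) * n = \<epsilon> * (3 + 4 / r * X) * n" for n X
    by (simp_all add: algebra_simps)
  have near: "norm (?b v *\<^sub>R ?H v - ?b w *\<^sub>R ?H w)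
      \<le> \<epsilon> * (2 + 4 / r * (1 + norm z + r)) * norm (v - w)" if v: "v \<in> ball z r" for v w
  proof -
    have "norm (?b v *\<^sub>R ?H v - ?b w *\<^sub>R ?H w)
        = norm ((?b v - ?b w) *\<^sub>R ?H v + ?b w *\<^sub>R (?H v - ?H w))"
      by (simp add: algebra_simps)
    also have "\<dots> \<le> \<bar>?b v - ?b w\<bar> * norm (?H v) + \<bar>?b w\<bar> * norm (?H v - ?H w)"
      by (metis norm_scaleR norm_triangle_ineq)
    also have "\<bar>?b v - ?b w\<bar> * norm (?H v) \<le> (2 / r * norm (v - w)) * (2 * \<epsilon> * (1 + norm z + r))"
      using bump_Lipschitz[OF r] Hb[OF v] r by (intro mult_mono) auto
    also have "\<bar>?b w\<bar> * norm (?H v - ?H w) \<le> 1 * (2 * \<epsilon> * norm (v - w))"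
      using bump_bounds[of z r w] Hl by (intro mult_mono) auto
    finally show ?thesis by (simp only: lipschitz_sum)
  qed
  have lip: "norm (?b v *\<^sub>R ?H v - ?b w *\<^sub>R ?H w)
      \<le> \<epsilon> * (2 + 4 / r * (1 + norm z + r)) * norm (v - w)" for v w
  proof (cases "v \<in> ball z r \<or> w \<in> ball z r")
    case True
    then show ?thesis using near[of v w] near[of w v] by (auto simp: norm_minus_commute)
  next
    case False
    then have "?b v = 0" "?b w = 0" using bump_eq_0[OF r] by blast+
    then show ?thesis using \<epsilon> r by simp
  qed
  show ?thesis unfolding small_perturbation_def
  proof (intro conjI allI)
    have "h1 0 + ?b 0 *\<^sub>R ?H 0 = (1 - ?b 0) *\<^sub>R h1 0 + ?b 0 *\<^sub>R h2 0"
      by (simp add: algebra_simps)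
    moreover have "norm ((1 - ?b 0) *\<^sub>R h1 0 + ?b 0 *\<^sub>R h2 0) \<le> (1 - ?b 0) * \<epsilon> + ?b 0 * \<epsilon>"
      using h bump_bounds[of z r 0] unfolding small_perturbation_def
      by (intro norm_triangle_mono) (auto intro: mult_left_mono)
    ultimately have "norm (h1 0 + ?b 0 *\<^sub>R ?H 0) \<le> \<epsilon> * 1" by (simp add: algebra_simps)
    also have "\<dots> \<le> \<epsilon> * ?K" using K \<epsilon> by (rule mult_left_mono)
    finally show "norm (h1 0 + ?b 0 *\<^sub>R ?H 0) \<le> \<epsilon> * ?K" .
    fix v w
    have "norm ((h1 v + ?b v *\<^sub>R ?H v) - (h1 w + ?b w *\<^sub>R ?H w))
        = norm ((h1 v - h1 w) + (?b v *\<^sub>R ?H v - ?b w *\<^sub>R ?H w))"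
      by (simp add: algebra_simps)
    also have "\<dots> \<le> \<epsilon> * norm (v - w) + \<epsilon> * (2 + 4 / r * (1 + norm z + r)) * norm (v - w)"
      using h(1) lip[of v w] unfolding small_perturbation_def by (intro norm_triangle_mono) auto
    finally show "norm ((h1 v + ?b v *\<^sub>R ?H v) - (h1 w + ?b w *\<^sub>R ?H w)) \<le> \<epsilon> * ?K * norm (v - w)"
      by (simp only: lipschitz_sum)
  qed
qed

text \<open>
  The set \<open>C w v\<close> consists of the admissible positions of the displaced point \<open>v\<close> for the parameter \<open>w\<close>.
  The local solutions are blended one after the other, along an induction on a finite cover. On the
  half-size ball the new solution replaces the old one, outside the ball the old one is kept, and in between
  convexity keeps the blend admissible.
\<close>

lemma small_perturbation_local_to_global:
  fixes D :: "'a::real_normed_vector set" and C :: "'w \<Rightarrow> 'a \<Rightarrow> 'a set"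
  assumes D: "compact D" and C: "\<And>w v. convex (C w v)"
    and loc: "\<And>z. z \<in> D \<Longrightarrow> \<exists>r>0. \<forall>\<epsilon>>0. \<forall>\<^sub>F w in F. \<exists>h. small_perturbation \<epsilon> h \<and>
                (\<forall>v \<in> D \<inter> ball z r. v + h v \<in> C w v)"
    and \<epsilon>: "0 < \<epsilon>"
  shows "\<forall>\<^sub>F w in F. \<exists>h. small_perturbation \<epsilon> h \<and> (\<forall>v \<in> D. v + h v \<in> C w v)"
proof -
  let ?P = "\<lambda>z r. 0 < r \<and> (\<forall>\<epsilon>>0. \<forall>\<^sub>F w in F. \<exists>h. small_perturbation \<epsilon> h \<and>
                (\<forall>v \<in> D \<inter> ball z r. v + h v \<in> C w v))"
  have "\<forall>z\<in>D. \<exists>r. ?P z r" using loc by blast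
  from bchoice[OF this] obtain r where rP: "\<forall>z\<in>D. ?P z (r z)" by blast
  have r: "0 < r z" "\<And>\<epsilon>. 0 < \<epsilon> \<Longrightarrow> \<forall>\<^sub>F w in F. \<exists>h. small_perturbation \<epsilon> h \<and>
                (\<forall>v \<in> D \<inter> ball z (r z). v + h v \<in> C w v)" if "z \<in> D" for z
    using bspec[OF rP that] by (rule conjunct1, blast)
  obtain Z where Z: "Z \<subseteq> D" "finite Z" "D \<subseteq> (\<Union>z\<in>Z. ball z (r z / 2))"
  proof (rule compactE_image[OF D, of D "\<lambda>z. ball z (r z / 2)"])
    show "D \<subseteq> (\<Union>z\<in>D. ball z (r z / 2))"
    proof
      fix z assume z: "z \<in> D"
      then have "z \<in> ball z (r z / 2)" using r(1) by simp
      with z show "z \<in> (\<Union>z\<in>D. ball z (r z / 2))" by blast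
    qed
  qed (rule open_ball, blast)
  have "\<forall>\<^sub>F w in F. \<exists>h. small_perturbation \<epsilon> h \<and>
          (\<forall>v \<in> D \<inter> (\<Union>z\<in>Z. ball z (r z / 2)). v + h v \<in> C w v)"
    using Z(2,1) \<epsilon>
  proof (induction Z arbitrary: \<epsilon> rule: finite_induct)
    case empty
    then show ?case by (intro always_eventually allI exI[of _ "\<lambda>_. 0"]) (simp add: small_perturbation_def)
  next
    case (insert z Z)
    have z: "z \<in> D" "0 < r z" using insert.prems r by auto
    define K where "K = 3 + 4 / r z * (1 + norm z + r z)"
    have K: "0 < K" unfolding K_def using z by (intro add_pos_nonneg mult_nonneg_nonneg) auto
    have e: "0 < \<epsilon> / K" using K insert.prems by simp
    have "\<forall>\<^sub>F w in F. \<exists>h. small_perturbation (\<epsilon> / K) h \<and>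
          (\<forall>v \<in> D \<inter> (\<Union>z\<in>Z. ball z (r z / 2)). v + h v \<in> C w v)"
      using insert.IH e insert.prems by blast
    moreover note r(2)[OF z(1) e]
    ultimately show ?case
    proof eventually_elim
      case (elim w)
      then obtain h1 h2 where h: "small_perturbation (\<epsilon> / K) h1" "small_perturbation (\<epsilon> / K) h2"
        and h1: "\<And>v. v \<in> D \<inter> (\<Union>z\<in>Z. ball z (r z / 2)) \<Longrightarrow> v + h1 v \<in> C w v"
        and h2: "\<And>v. v \<in> D \<inter> ball z (r z) \<Longrightarrow> v + h2 v \<in> C w v"
        by blast
      define h where "h v = h1 v + bump z (r z) v *\<^sub>R (h2 v - h1 v)" for v
      have "small_perturbation \<epsilon> h"
        using small_perturbation_blend[OF z(2) _ h, of z] e K unfolding h_def K_def[symmetric] by simp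
      moreover have "v + h v \<in> C w v" if v: "v \<in> D" "v \<in> (\<Union>z\<in>insert z Z. ball z (r z / 2))" for v
      proof -
        consider "v \<in> ball z (r z / 2)" | "v \<in> (\<Union>z\<in>Z. ball z (r z / 2))" "v \<in> ball z (r z)"
          | "v \<in> (\<Union>z\<in>Z. ball z (r z / 2))" "v \<notin> ball z (r z)"
          using v by auto
        then show ?thesis
        proof cases
          case 1
          then have "v \<in> ball z (r z)" using z by auto
          then show ?thesis using 1 h2 v bump_eq_1[OF z(2) 1] by (simp add: h_def)
        next
          case 2
          have "v + h v = (1 - bump z (r z) v) *\<^sub>R (v + h1 v) + bump z (r z) v *\<^sub>R (v + h2 v)"
            by (simp add: h_def algebra_simps)
          then show ?thesis
            using convexD[OF C, of "v + h1 v" w v "v + h2 v" "1 - bump z (r z) v" "bump z (r z) v"]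
              h1 h2 v 2 bump_bounds[of z "r z" v] by simp
        next
          case 3
          then show ?thesis using h1 v bump_eq_0[OF z(2) 3(2)] by (simp add: h_def)
        qed
      qed
      ultimately show ?case by blast
    qed
  qed
  then show ?thesis by (rule eventually_mono) (use Z(3) in blast)
qed

text \<open>
  Solving \<open>v + h v = y\<close> is a fixed point problem for the contraction \<open>v \<mapsto> y - h v\<close>, and the
  inverse is Lipschitz since \<open>h\<close> cannot undo more than half of a displacement.
\<close>

lemma homeomorphism_perturbed_identity:
  fixes h :: "'a::banach \<Rightarrow> 'a"
  assumes h: "small_perturbation (1/2) h"
  obtains G where "homeomorphism UNIV UNIV (\<lambda>v. v + h v) G"
proof -
  let ?F = "\<lambda>v. v + h v"
  have lip: "norm (h v - h w) \<le> 1/2 * norm (v - w)" for v w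
    using h unfolding small_perturbation_def by blast
  have expand: "norm (v - w) \<le> 2 * norm (?F v - ?F w)" for v w
  proof -
    have "v - w = (?F v - ?F w) - (h v - h w)" by simp
    then have "norm (v - w) \<le> norm (?F v - ?F w) + norm (h v - h w)" by (metis norm_triangle_ineq4)
    then show ?thesis using lip[of v w] by simp
  qed
  have surj: "\<exists>v. ?F v = y" for y
  proof -
    have "\<exists>!v. y - h v = v"
      using lip by (intro banach_fix_type[of "1/2"]) (auto simp: dist_norm norm_minus_commute)
    then show ?thesis by (metis add.commute diff_add_cancel)
  qed
  obtain G where G: "?F (G y) = y" for y using surj by metis
  have GF: "G (?F v) = v" for v using expand[of "G (?F v)" v] G by simp
  have "(1/2)-lipschitz_on UNIV h" using lip by (auto simp: lipschitz_on_def dist_norm)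
  then have "continuous_on UNIV h" by (rule lipschitz_on_continuous_on)
  moreover have "2-lipschitz_on UNIV G"
    unfolding lipschitz_on_def dist_norm using expand[of "G x" "G y" for x y, unfolded G] by simp
  then have "continuous_on UNIV G" by (rule lipschitz_on_continuous_on)
  ultimately have "homeomorphism UNIV UNIV ?F G"
    unfolding homeomorphism_def
    by (intro conjI ballI continuous_intros GF G surjI[of ?F G] surjI[of G ?F])
  then show ?thesis by (rule that)
qed

text \<open>
  During the homotopy \<open>v \<mapsto> v + s h v\<close> the distance of two points never shrinks to zero, so the
  deformed loop never meets the deformed centre.
\<close>

lemma winding_number_perturbed_identity:
  fixes h :: "complex \<Rightarrow> complex"
  assumes h: "small_perturbation (1/2) h"
    and \<gamma>: "path \<gamma>" "pathfinish \<gamma> = pathstart \<gamma>" "z \<notin> path_image \<gamma>"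
  shows "winding_number (\<lambda>t. \<gamma> t + h (\<gamma> t)) (z + h z) = winding_number \<gamma> z"
proof -
  have lip: "norm (h v - h w) \<le> 1/2 * norm (v - w)" for v w
    using h unfolding small_perturbation_def by blast
  have "(1/2)-lipschitz_on UNIV h" using lip by (auto simp: lipschitz_on_def dist_norm)
  then have ch: "continuous_on UNIV h" by (rule lipschitz_on_continuous_on)
  have cg: "continuous_on {0..1} \<gamma>" using \<gamma>(1) by (simp add: path_def)
  have "homotopic_loops (- {0}) (\<lambda>t. \<gamma> t - z) (\<lambda>t. \<gamma> t + h (\<gamma> t) - (z + h z))"
    unfolding homotopic_loops
  proof (intro exI conjI ballI)
    let ?h = "\<lambda>x::real\<times>real. (\<gamma> (snd x) - z) + of_real (fst x) * (h (\<gamma> (snd x)) - h z)"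
    show "continuous_on ({0..1} \<times> {0..1}) ?h"
      by (intro continuous_intros continuous_on_compose2[OF ch] continuous_on_compose2[OF cg]) auto
    show "?h \<in> {0..1} \<times> {0..1} \<rightarrow> - {0}"
    proof
      fix x :: "real \<times> real" assume x: "x \<in> {0..1} \<times> {0..1}"
      have "\<gamma> (snd x) \<noteq> z" using \<gamma>(3) x by (auto simp: path_image_def)
      then have p: "0 < norm (\<gamma> (snd x) - z)" by simp
      have "norm (of_real (fst x) * (h (\<gamma> (snd x)) - h z)) \<le> 1 * norm (h (\<gamma> (snd x)) - h z)"
        unfolding norm_mult using x by (intro mult_right_mono) auto
      also have "\<dots> < norm (\<gamma> (snd x) - z)" using lip[of "\<gamma> (snd x)" z] p by linarith
      finally have "?h x \<noteq> 0" by (metis add_eq_0_iff norm_minus_cancel less_irrefl)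
      then show "?h x \<in> - {0}" by simp
    qed
    show "pathfinish (?h \<circ> Pair t) = pathstart (?h \<circ> Pair t)" for t
      using \<gamma>(2) by (simp add: pathfinish_def pathstart_def)
  qed (auto simp: algebra_simps)
  then have "winding_number (\<lambda>t. \<gamma> t - z) 0 = winding_number (\<lambda>t. \<gamma> t + h (\<gamma> t) - (z + h z)) 0"
    by (rule winding_number_homotopic_loops)
  then show ?thesis
    using winding_number_offset[of \<gamma> z] winding_number_offset[of "\<lambda>t. \<gamma> t + h (\<gamma> t)" "z + h z"] by simp
qed


section \<open>Edges of a polygonal arc\<close>

lemma pathstart_polygonal_path: "vs \<noteq> [] \<Longrightarrow> pathstart (polygonal_path vs) = hd vs"
  by (induction vs rule: polygonal_path.induct) (auto simp: pathstart_def linepath_def joinpaths_def)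

lemma pathfinish_polygonal_path: "vs \<noteq> [] \<Longrightarrow> pathfinish (polygonal_path vs) = last vs"
  by (induction vs rule: polygonal_path.induct) auto

definition edge :: "'a::real_normed_vector list \<Rightarrow> nat \<Rightarrow> 'a set" where
  "edge vs i = closed_segment (vs ! i) (vs ! Suc i)"

definition edge_dir :: "'a::real_normed_vector list \<Rightarrow> nat \<Rightarrow> 'a" where
  "edge_dir vs i = vs ! Suc i - vs ! i"

lemma edge_Cons: "edge (a # vs) (Suc i) = edge vs i"
  by (simp add: edge_def)

lemma path_image_polygonal_path:
  "2 \<le> length vs \<Longrightarrow> path_image (polygonal_path vs) = (\<Union>i\<in>{i. Suc i < length vs}. edge vs i)"
proof (induction vs rule: polygonal_path.induct)
  case (3 a b)
  have "{i. Suc i < length [a, b]} = {0}" by auto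
  then show ?case by (simp add: edge_def)
next
  case (4 a b c vs)
  have eq: "{i. Suc i < length (a # b # c # vs)} = insert 0 (Suc ` {i. Suc i < length (b # c # vs)})"
    by (auto simp: image_iff) (metis Suc_less_SucD Suc_lessD gr0_implies_Suc not_gr_zero)
  have "path_image (polygonal_path (a # b # c # vs))
      = closed_segment a b \<union> path_image (polygonal_path (b # c # vs))"
    by (simp add: path_image_join pathstart_polygonal_path)
  then show ?case unfolding eq using 4 by (simp add: edge_Cons) (simp add: edge_def)
qed auto

lemma arc_polygonal_path_length: "arc (polygonal_path vs) \<Longrightarrow> 2 \<le> length vs"
  by (cases vs rule: polygonal_path.cases) (auto dest: arc_distinct_ends)

lemma arc_polygonal_path_Cons:
  assumes "arc (polygonal_path (a # b # c # vs))"
  shows "a \<noteq> b" "arc (polygonal_path (b # c # vs))"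
    "closed_segment a b \<inter> path_image (polygonal_path (b # c # vs)) \<subseteq> {b}"
  using assms by (auto simp: arc_join_eq pathstart_polygonal_path dest: arc_distinct_ends)

lemma arc_polygonal_path_edge_nontrivial:
  assumes "arc (polygonal_path vs)" "Suc i < length vs"
  shows "vs ! i \<noteq> vs ! Suc i"
  using assms
proof (induction vs arbitrary: i rule: polygonal_path.induct)
  case (3 a b)
  then show ?case using arc_distinct_ends[OF 3(1)] by simp
next
  case (4 a b c vs)
  then show ?case using arc_polygonal_path_Cons[OF "4.prems"(1)] by (cases i) auto
qed auto

text \<open>
  Injectivity of the path separates the first edge from the remaining ones, except at their common
  vertex; that vertex lies on no later edge than the second because the second edge is not degenerate.
\<close>

lemma arc_polygonal_path_edges_meet:
  assumes "arc (polygonal_path vs)" "i < j" "Suc j < length vs" "x \<in> edge vs i" "x \<in> edge vs j"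
  shows "j = Suc i \<and> x = vs ! j"
  using assms
proof (induction vs arbitrary: i j rule: polygonal_path.induct)
  case (4 a b c vs)
  note c = arc_polygonal_path_Cons[OF "4.prems"(1)]
  obtain j' where j: "j = Suc j'" using "4.prems"(2) by (cases j) auto
  have xj: "x \<in> edge (b # c # vs) j'" and j': "Suc j' < length (b # c # vs)"
    using "4.prems" by (simp_all add: j edge_Cons)
  show ?case
  proof (cases i)
    case (Suc i')
    then show ?thesis using "4.IH"[OF c(2), of i' j'] xj j' "4.prems" by (simp add: j edge_Cons)
  next
    case 0
    have "x \<in> path_image (polygonal_path (b # c # vs))"
      using xj j' by (subst path_image_polygonal_path) auto
    then have x: "x = b" using "4.prems" 0 c(3) by (auto simp: edge_def)
    have "j' = 0"
    proof (rule ccontr)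
      assume "j' \<noteq> 0"
      moreover have "b \<in> edge (b # c # vs) 0" by (simp add: edge_def)
      ultimately have "b = (b # c # vs) ! j'" "j' = Suc 0"
        using "4.IH"[OF c(2), of 0 j'] xj j' x by auto
      then show False using arc_polygonal_path_edge_nontrivial[OF c(2), of 0] by simp
    qed
    then show ?thesis using 0 j x by simp
  qed
qed auto

locale polygonal_arc =
  fixes vs :: "(real^3) list" and L :: oriented_arc
  assumes vertices: "vertex_list_of vs L"
begin

lemma arc_vs: "arc (polygonal_path vs)"
  using vertices by (simp add: vertex_list_of_def)

lemma length_vs: "2 \<le> length vs"
  using arc_polygonal_path_length[OF arc_vs] .

lemma support_eq: "support L = (\<Union>i\<in>{i. Suc i < length vs}. edge vs i)"
  using vertices path_image_polygonal_path[OF length_vs] by (simp add: vertex_list_of_def)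

lemma edge_subset_support: "Suc i < length vs \<Longrightarrow> edge vs i \<subseteq> support L"
  by (auto simp: support_eq)

lemma in_supportE:
  assumes "x \<in> support L"
  obtains i where "Suc i < length vs" "x \<in> edge vs i"
  using assms by (auto simp: support_eq)

lemma vertex_in_support: "k < length vs \<Longrightarrow> vs ! k \<in> support L"
proof (cases k)
  case 0
  then show ?thesis using length_vs edge_subset_support[of 0] by (auto simp: edge_def)
next
  case (Suc i)
  then show "k < length vs \<Longrightarrow> vs ! k \<in> support L"
    using edge_subset_support[of i] by (auto simp: edge_def)
qed

lemma init_pt_eq: "init_pt L = vs ! 0" and term_pt_eq: "term_pt L = vs ! (length vs - 1)"
proof -
  have "vs \<noteq> []" using length_vs by auto
  then show "init_pt L = vs ! 0" "term_pt L = vs ! (length vs - 1)"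
    using vertices pathstart_polygonal_path[of vs] pathfinish_polygonal_path[of vs]
    by (simp_all add: vertex_list_of_def hd_conv_nth last_conv_nth)
qed

lemma edge_dir_nonzero: "Suc i < length vs \<Longrightarrow> edge_dir vs i \<noteq> 0"
  using arc_polygonal_path_edge_nontrivial[OF arc_vs, of i] by (simp add: edge_dir_def)

lemma edges_meet_vertex:
  assumes "Suc i < length vs" "Suc j < length vs" "i \<noteq> j" "x \<in> edge vs i" "x \<in> edge vs j"
  shows "\<exists>k < length vs. x = vs ! k"
  using arc_polygonal_path_edges_meet[OF arc_vs, of i j x] arc_polygonal_path_edges_meet[OF arc_vs, of j i x]
    assms by (cases "i < j") (auto dest: Suc_lessD)

lemma closed_edge: "closed (edge vs i)" and compact_edge: "compact (edge vs i)"
  by (simp_all add: edge_def compact_segment closed_segment)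

lemma finite_edge_indices: "finite {i. Suc i < length vs}"
  by (rule finite_subset[of _ "{..<length vs}"]) auto

lemma compact_support: "compact (support L)"
  unfolding support_eq by (intro compact_UN compact_edge finite_edge_indices)

lemma edge_param:
  assumes "x \<in> edge vs i"
  obtains t where "0 \<le> t" "t \<le> 1" "x = vs ! i + t *\<^sub>R edge_dir vs i"
  using assms by (auto simp: edge_def edge_dir_def in_segment algebra_simps)

lemma edge_diff_span:
  assumes "x \<in> edge vs i" "y \<in> edge vs i"
  shows "x - y \<in> span {edge_dir vs i}"
proof -
  obtain s t where "x = vs ! i + t *\<^sub>R edge_dir vs i" "y = vs ! i + s *\<^sub>R edge_dir vs i"
    using assms edge_param by metis
  then have "x - y = (t - s) *\<^sub>R edge_dir vs i" by (simp add: algebra_simps)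
  then show ?thesis by (auto simp: span_singleton)
qed

end


section \<open>Coordinates in the plane of projection\<close>

lemma frame_coord_linear: "linear (frame_coord e1 e2)"
  by (rule linearI) (auto simp: frame_coord_def inner_add_left complex_eq_iff)

text \<open>
  For an orthonormal pair, the inverse of \<open>frame_coord e1 e2\<close> on the plane that the pair spans.
\<close>

definition frame_point :: "real^3 \<Rightarrow> real^3 \<Rightarrow> complex \<Rightarrow> real^3" where
  "frame_point e1 e2 c = Re c *\<^sub>R e1 + Im c *\<^sub>R e2"

text \<open>
  These facts replace the projection along \<open>u\<close> by the linear coordinate map into the complex plane,
  which has the same fibres. The last one expresses the determinant of two coordinate vectors as a
  triple product in space; this makes transversality polynomial in the direction \<open>u\<close>.
\<close>

lemma frame_coord_lemmas:
  assumes "positive_frame u e1 e2"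
  shows "norm u = 1" "e1 \<bullet> u = 0" "e2 \<bullet> u = 0"
    and frame_coord_frame_point: "frame_coord e1 e2 (frame_point e1 e2 c) = c"
    and frame_point_in_plane: "frame_point e1 e2 c \<in> plane u"
    and frame_point_frame_coord: "x \<in> plane u \<Longrightarrow> frame_point e1 e2 (frame_coord e1 e2 x) = x"
    and proj_eq_frame_point: "proj u x = frame_point e1 e2 (frame_coord e1 e2 x)"
    and frame_coord_proj: "frame_coord e1 e2 (proj u x) = frame_coord e1 e2 x"
    and proj_eq_iff: "proj u x = proj u y \<longleftrightarrow> frame_coord e1 e2 x = frame_coord e1 e2 y"
    and frame_coord_eq_0_iff: "frame_coord e1 e2 x = 0 \<longleftrightarrow> (\<exists>c. x = c *\<^sub>R u)"
    and cross_dot_frame: "cross3 a b \<bullet> u = Re (frame_coord e1 e2 a) * Im (frame_coord e1 e2 b)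
          - Im (frame_coord e1 e2 a) * Re (frame_coord e1 e2 b)"
proof -
  have e: "e1 \<bullet> e1 = 1" "e2 \<bullet> e2 = 1" "e1 \<bullet> e2 = 0" "e2 \<bullet> e1 = 0" "cross3 e1 e2 = u"
    using assms by (auto simp: positive_frame_def norm_eq_1 inner_commute)
  have "norm e1 = 1" "norm e2 = 1" using assms by (auto simp: positive_frame_def)
  then show n: "norm u = 1"
    using norm_cross_dot[of e1 e2] e by (simp add: power2_eq_1_iff) (smt (verit) norm_ge_zero)
  then have uu: "u \<bullet> u = 1" by (simp add: norm_eq_1)
  show eu: "e1 \<bullet> u = 0" "e2 \<bullet> u = 0" using e(5) dot_cross_self by metis+
  show cp: "frame_coord e1 e2 (frame_point e1 e2 c) = c" for c
    using e by (simp add: frame_coord_def frame_point_def inner_add_left complex_eq_iff)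
  show "frame_point e1 e2 c \<in> plane u" for c
    using eu by (simp add: plane_def frame_point_def inner_add_left)
  show pc: "x \<in> plane u \<Longrightarrow> frame_point e1 e2 (frame_coord e1 e2 x) = x" for x
    using plane_eqI[OF assms, of x] by (simp add: frame_point_def frame_coord_def)
  show cproj: "frame_coord e1 e2 (proj u x) = frame_coord e1 e2 x" for x
    using eu by (simp add: frame_coord_def proj_def inner_diff_left inner_diff_right inner_commute)
  have "proj u x \<in> plane u" for x using uu by (simp add: proj_def plane_def inner_diff_left)
  from pc[OF this] show pf: "proj u x = frame_point e1 e2 (frame_coord e1 e2 x)" for x
    by (simp add: cproj)
  show "proj u x = proj u y \<longleftrightarrow> frame_coord e1 e2 x = frame_coord e1 e2 y"
    by (metis pf cp)
  show "frame_coord e1 e2 x = 0 \<longleftrightarrow> (\<exists>c. x = c *\<^sub>R u)"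
  proof
    assume "frame_coord e1 e2 x = 0"
    then have "proj u x = 0" by (simp add: pf frame_point_def)
    then have "x = (x \<bullet> u) *\<^sub>R u" by (simp add: proj_def)
    then show "\<exists>c. x = c *\<^sub>R u" ..
  qed (use eu in \<open>auto simp: frame_coord_def complex_eq_iff inner_commute\<close>)
  show "cross3 a b \<bullet> u = Re (frame_coord e1 e2 a) * Im (frame_coord e1 e2 b)
          - Im (frame_coord e1 e2 a) * Re (frame_coord e1 e2 b)"
    using dot_cross[of a b e1 e2] e(5) by (simp add: frame_coord_def)
qed

lemma collinear_projections_iff:
  assumes "positive_frame u e1 e2"
  shows "collinear {0, proj u a, proj u b} \<longleftrightarrow> cross3 a b \<bullet> u = 0"
proof -
  note f = frame_coord_lemmas[OF assms]
  have p: "proj u x \<bullet> u = 0" for x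
    using f(1) by (simp add: proj_def inner_diff_left norm_eq_1)
  have c: "cross3 (proj u a) (proj u b) \<bullet> u = cross3 a b \<bullet> u"
    by (simp add: cross_dot_frame[OF assms] frame_coord_proj[OF assms])
  have "cross3 u (cross3 (proj u a) (proj u b)) = 0"
    using p by (simp add: Lagrange inner_commute)
  then have "cross3 (proj u a) (proj u b) = 0 \<longleftrightarrow> cross3 (proj u a) (proj u b) \<bullet> u = 0"
    using norm_and_cross_eq_0[of u "cross3 (proj u a) (proj u b)"] f(1) by (auto simp: inner_commute)
  then show ?thesis using c by (simp add: cross_eq_0)
qed

text \<open>
  Gram-Schmidt applied to a fixed auxiliary vector \<open>a\<close>, so that the coordinates depend continuously on \<open>u\<close>
  and two nearby directions can be compared.
\<close>

definition frame1 :: "real^3 \<Rightarrow> real^3 \<Rightarrow> real^3" where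
  "frame1 a u = proj u a /\<^sub>R norm (proj u a)"

definition frame2 :: "real^3 \<Rightarrow> real^3 \<Rightarrow> real^3" where
  "frame2 a u = cross3 u (frame1 a u)"

abbreviation coord :: "real^3 \<Rightarrow> real^3 \<Rightarrow> real^3 \<Rightarrow> complex" where
  "coord a u \<equiv> frame_coord (frame1 a u) (frame2 a u)"

lemma positive_frame_frame:
  assumes "norm u = 1" "proj u a \<noteq> 0"
  shows "positive_frame u (frame1 a u) (frame2 a u)"
proof -
  have n: "norm (frame1 a u) = 1" using assms by (simp add: frame1_def)
  have o: "frame1 a u \<bullet> u = 0"
    using assms by (simp add: frame1_def proj_def inner_diff_left norm_eq_1)
  have "(norm (frame2 a u))\<^sup>2 = 1"
    using norm_cross_dot[of u "frame1 a u"] n o assms by (simp add: frame2_def inner_commute)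
  then have n2: "norm (frame2 a u) = 1" by (simp add: power2_eq_1_iff) (smt (verit) norm_ge_zero)
  have "cross3 (frame1 a u) (frame2 a u) = u"
    unfolding frame2_def Lagrange using n o by (simp add: norm_eq_1)
  then show ?thesis using n n2 by (simp add: positive_frame_def frame2_def dot_cross_self)
qed

lemma tendsto_frames:
  assumes "proj u0 a \<noteq> 0"
  shows "(frame1 a \<longlongrightarrow> frame1 a u0) (at u0 within S)" "(frame2 a \<longlongrightarrow> frame2 a u0) (at u0 within S)"
proof -
  have c1: "continuous (at u0 within S) (frame1 a)"
    using assms unfolding frame1_def proj_def
    by (intro continuous_intros) auto
  then show "(frame1 a \<longlongrightarrow> frame1 a u0) (at u0 within S)" by (simp add: continuous_within)
  have "continuous (at u0 within S) (frame2 a)"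
    unfolding frame2_def by (intro continuous_cross c1 continuous_intros)
  then show "(frame2 a \<longlongrightarrow> frame2 a u0) (at u0 within S)" by (simp add: continuous_within)
qed

lemma eventually_positive_frame:
  assumes "proj u0 a \<noteq> 0"
  shows "\<forall>\<^sub>F u in at u0 within sphere 0 1. positive_frame u (frame1 a u) (frame2 a u)"
proof -
  have "continuous (at u0 within sphere 0 1) (\<lambda>u. proj u a)"
    unfolding proj_def by (intro continuous_intros)
  then have "\<forall>\<^sub>F u in at u0 within sphere 0 1. proj u a \<noteq> 0"
    using assms by (intro tendsto_imp_eventually_ne) (auto simp: continuous_within)
  moreover have "\<forall>\<^sub>F u in at u0 within sphere 0 1. u \<in> sphere 0 1"
    by (simp add: eventually_at_filter)
  ultimately show ?thesis by eventually_elim (auto intro: positive_frame_frame)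
qed

lemma frame_coord_diff_bound:
  "norm (frame_coord e1 e2 x - frame_coord e1' e2' x) \<le> (norm (e1 - e1') + norm (e2 - e2')) * norm x"
proof -
  have "frame_coord e1 e2 x - frame_coord e1' e2' x = Complex (x \<bullet> (e1 - e1')) (x \<bullet> (e2 - e2'))"
    by (simp add: frame_coord_def complex_eq_iff inner_diff_right)
  moreover have "norm (Complex (x \<bullet> (e1 - e1')) (x \<bullet> (e2 - e2')))
      \<le> \<bar>x \<bullet> (e1 - e1')\<bar> + \<bar>x \<bullet> (e2 - e2')\<bar>"
    using cmod_le[of "Complex (x \<bullet> (e1 - e1')) (x \<bullet> (e2 - e2'))"] by simp
  moreover have "\<bar>x \<bullet> (e1 - e1')\<bar> \<le> norm x * norm (e1 - e1')" "\<bar>x \<bullet> (e2 - e2')\<bar> \<le> norm x * norm (e2 - e2')"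
    by (rule Cauchy_Schwarz_ineq2)+
  ultimately show ?thesis by (simp add: algebra_simps)
qed

text \<open>
  The affine map \<open>v \<mapsto> x + g (v - z)\<close> lifts the plane to space. Projecting the lifted points in the
  direction \<open>u\<close> instead of \<open>u\<^sub>0\<close> moves them by an affine map whose coefficients tend to \<open>0\<close> with \<open>u \<rightarrow> u\<^sub>0\<close>; the
  term \<open>e u\<close> leaves room for an additional translation.
\<close>

lemma eventually_small_perturbation_coord:
  assumes a: "proj u0 a \<noteq> 0" and g: "linear g" and e: "(e \<longlongrightarrow> 0) (at u0 within sphere 0 1)"
    and \<epsilon>: "0 < \<epsilon>"
  shows "\<forall>\<^sub>F u in at u0 within sphere 0 1.
           small_perturbation \<epsilon> (\<lambda>v. coord a u (x + g (v - z)) - coord a u0 (x + g (v - z)) + e u)"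
proof -
  obtain B where B: "0 < B" "\<And>v. norm (g v) \<le> norm v * B"
    using bounded_linear.pos_bounded[of g] g by (auto simp: linear_conv_bounded_linear)
  define \<kappa> where "\<kappa> u = norm (frame1 a u - frame1 a u0) + norm (frame2 a u - frame2 a u0)" for u
  define c where "c = B + norm (x - g z)"
  have "((\<lambda>u. \<kappa> u * c + norm (e u)) \<longlongrightarrow> (norm (frame1 a u0 - frame1 a u0) +
      norm (frame2 a u0 - frame2 a u0)) * c + norm (0::complex)) (at u0 within sphere 0 1)"
    unfolding \<kappa>_def by (intro tendsto_intros tendsto_frames a e)
  then have "((\<lambda>u. \<kappa> u * c + norm (e u)) \<longlongrightarrow> 0) (at u0 within sphere 0 1)" by simp
  then have "\<forall>\<^sub>F u in at u0 within sphere 0 1. \<kappa> u * c + norm (e u) < \<epsilon>"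
    using \<epsilon> by (rule order_tendstoD)
  then show ?thesis
  proof eventually_elim
    case (elim u)
    let ?A = "coord a u" and ?B = "coord a u0"
    have \<kappa>: "0 \<le> \<kappa> u" by (simp add: \<kappa>_def)
    have d: "norm (?A y - ?B y) \<le> \<kappa> u * norm y" for y
      unfolding \<kappa>_def by (rule frame_coord_diff_bound)
    have k: "\<kappa> u * B \<le> \<epsilon>" "\<kappa> u * norm (x - g z) + norm (e u) \<le> \<epsilon>"
    proof -
      have "0 \<le> \<kappa> u * B" "0 \<le> \<kappa> u * norm (x - g z)" "0 \<le> norm (e u)" using \<kappa> B(1) by simp_all
      then show "\<kappa> u * B \<le> \<epsilon>" "\<kappa> u * norm (x - g z) + norm (e u) \<le> \<epsilon>"
        using elim unfolding c_def distrib_left by linarith+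
    qed
    show ?case unfolding small_perturbation_def
    proof (intro conjI allI)
      have gz: "x + g (0 - z) = x - g z" using linear_neg[OF g, of z] by simp
      show "norm (?A (x + g (0 - z)) - ?B (x + g (0 - z)) + e u) \<le> \<epsilon>"
        unfolding gz using d[of "x - g z"] k(2)
          norm_triangle_ineq[of "?A (x - g z) - ?B (x - g z)" "e u"] by linarith
      fix v w
      have gd: "g (v - z) - g (w - z) = g (v - w)" using linear_diff[OF g] by (metis diff_diff_eq2 diff_add_cancel)
      have "(?A (x + g (v - z)) - ?B (x + g (v - z)) + e u) - (?A (x + g (w - z)) - ?B (x + g (w - z)) + e u)
          = ?A (g (v - z) - g (w - z)) - ?B (g (v - z) - g (w - z))"
        by (simp add: linear_add[OF frame_coord_linear] linear_diff[OF frame_coord_linear])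
      also have "norm \<dots> \<le> \<kappa> u * norm (g (v - w))" unfolding gd by (rule d)
      also have "\<dots> \<le> \<kappa> u * (norm (v - w) * B)" by (intro mult_left_mono B \<kappa>)
      also have "\<dots> \<le> \<epsilon> * norm (v - w)" using mult_right_mono[OF k(1), of "norm (v - w)"] by (simp add: ac_simps)
      finally show "norm ((?A (x + g (v - z)) - ?B (x + g (v - z)) + e u)
          - (?A (x + g (w - z)) - ?B (x + g (w - z)) + e u)) \<le> \<epsilon> * norm (v - w)" .
    qed
  qed
qed

text \<open>
  Cramer's rule in the plane of projection. The determinants are triple products in space, so the
  coefficients depend continuously on \<open>u\<close>.
\<close>

lemma frame_coord_Cramer:
  assumes "positive_frame u e1 e2" "cross3 a b \<bullet> u \<noteq> 0"
  shows "frame_coord e1 e2 c = ((cross3 c b \<bullet> u) / (cross3 a b \<bullet> u)) *\<^sub>R frame_coord e1 e2 a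
           + ((cross3 a c \<bullet> u) / (cross3 a b \<bullet> u)) *\<^sub>R frame_coord e1 e2 b"
proof -
  have "(cross3 a b \<bullet> u) *\<^sub>R frame_coord e1 e2 c
      = (cross3 c b \<bullet> u) *\<^sub>R frame_coord e1 e2 a + (cross3 a c \<bullet> u) *\<^sub>R frame_coord e1 e2 b"
    unfolding cross_dot_frame[OF assms(1)] by (simp add: complex_eq_iff algebra_simps)
  then have "(1 / (cross3 a b \<bullet> u)) *\<^sub>R (cross3 a b \<bullet> u) *\<^sub>R frame_coord e1 e2 c
      = (1 / (cross3 a b \<bullet> u)) *\<^sub>R
        ((cross3 c b \<bullet> u) *\<^sub>R frame_coord e1 e2 a + (cross3 a c \<bullet> u) *\<^sub>R frame_coord e1 e2 b)"
    by (rule arg_cong)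
  then show ?thesis using assms(2) by (simp add: scaleR_add_right)
qed

lemma tendsto_coord:
  assumes "proj u0 a \<noteq> 0"
  shows "((\<lambda>u. coord a u x) \<longlongrightarrow> coord a u0 x) (at u0 within S)"
  unfolding frame_coord_def by (intro tendsto_intros tendsto_frames assms)

lemma ball_meets_only_incident:
  assumes "finite \<C>" "\<And>S. S \<in> \<C> \<Longrightarrow> closed S"
  shows "\<exists>r>0. \<forall>S\<in>\<C>. S \<inter> ball z r \<noteq> {} \<longrightarrow> z \<in> S"
proof -
  have "closed (\<Union>{S \<in> \<C>. z \<notin> S})" using assms by (intro closed_Union) auto
  then have "open (- \<Union>{S \<in> \<C>. z \<notin> S})" "z \<in> - \<Union>{S \<in> \<C>. z \<notin> S}" by auto
  then obtain r where "r > 0" "ball z r \<subseteq> - \<Union>{S \<in> \<C>. z \<notin> S}" by (meson openE)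
  then show ?thesis by (intro exI[of _ r]) blast
qed

text \<open>
  A projection is injective on every subspace that does not contain the projection direction, so the vectors
  of the subspace can be recovered linearly from their images.
\<close>

lemma linear_section_on_span:
  assumes f: "positive_frame u e1 e2" and u: "u \<notin> span V"
  obtains g where "linear g" "\<And>d. d \<in> span V \<Longrightarrow> g (frame_coord e1 e2 d) = d"
proof -
  have "inj_on (frame_coord e1 e2) (span V)"
  proof (rule inj_onI)
    fix x y assume xy: "x \<in> span V" "y \<in> span V" "frame_coord e1 e2 x = frame_coord e1 e2 y"
    then have "frame_coord e1 e2 (x - y) = 0" by (simp add: linear_diff[OF frame_coord_linear])
    then obtain c where c: "x - y = c *\<^sub>R u" using frame_coord_eq_0_iff[OF f] by blast
    have "c = 0"
    proof (rule ccontr)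
      assume "c \<noteq> 0"
      then have "u = (1 / c) *\<^sub>R (x - y)" by (simp add: c)
      then show False using u xy span_diff span_scale by metis
    qed
    then show "x = y" using c by simp
  qed
  from linear_inj_on_left_inverse[OF frame_coord_linear this] show ?thesis using that by blast
qed


section \<open>Regular directions\<close>

context polygonal_arc
begin

text \<open>
  The second condition says that the projection does not fold the arc over at a vertex and does not
  collapse an edge. It allows a neighbourhood of each point of the arc to be lifted linearly from
  its image.
\<close>

definition regular :: "real^3 \<Rightarrow> bool" where
  "regular u \<longleftrightarrow>
     (\<forall>k < length vs. fibre L u (proj u (vs ! k)) = {vs ! k}) \<and>
     (\<forall>x. u \<notin> span {edge_dir vs i | i. Suc i < length vs \<and> x \<in> edge vs i}) \<and>
     (\<forall>p \<in> multiple_points L u. crossing_point vs L u p)"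

lemma regular_projects_to_diagram: "regular u \<Longrightarrow> projects_to_diagram L u"
  unfolding regular_def projects_to_diagram_def init_pt_eq term_pt_eq
proof (elim conjE, intro conjI exI[of _ vs])
  assume fib: "\<forall>k < length vs. fibre L u (proj u (vs ! k)) = {vs ! k}"
  have "0 < length vs" "length vs - 1 < length vs" using length_vs by auto
  with fib show "fibre L u (proj u (vs ! 0)) = {vs ! 0}"
    "fibre L u (proj u (vs ! (length vs - 1))) = {vs ! (length vs - 1)}" by blast+
qed (rule vertices)

lemma regular_vertex:
  assumes "regular u" "positive_frame u e1 e2" "k < length vs" "x \<in> support L"
    "frame_coord e1 e2 x = frame_coord e1 e2 (vs ! k)"
  shows "x = vs ! k"
proof -
  have "x \<in> fibre L u (proj u (vs ! k))" using assms by (simp add: fibre_def proj_eq_iff)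
  then show ?thesis using assms by (simp add: regular_def)
qed

lemma regular_edge_dir:
  assumes "regular u" "positive_frame u e1 e2" "Suc i < length vs"
  shows "frame_coord e1 e2 (edge_dir vs i) \<noteq> 0"
proof
  assume "frame_coord e1 e2 (edge_dir vs i) = 0"
  then obtain c where c: "edge_dir vs i = c *\<^sub>R u" using frame_coord_eq_0_iff[OF assms(2)] by blast
  then have "c \<noteq> 0" using edge_dir_nonzero[OF assms(3)] by auto
  then have u: "u = (1 / c) *\<^sub>R edge_dir vs i" by (simp add: c)
  have "edge_dir vs i \<in> {edge_dir vs j | j. Suc j < length vs \<and> vs ! i \<in> edge vs j}"
    using assms(3) by (auto simp: edge_def)
  then have "u \<in> span {edge_dir vs j | j. Suc j < length vs \<and> vs ! i \<in> edge vs j}"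
    by (subst u) (intro span_scale span_base)
  then show False using assms(1) by (simp add: regular_def)
qed

lemma regular_inj_on_edge:
  assumes "regular u" "positive_frame u e1 e2" "Suc i < length vs"
  shows "inj_on (frame_coord e1 e2) (edge vs i)"
proof (rule inj_onI)
  fix x y assume xy: "x \<in> edge vs i" "y \<in> edge vs i" "frame_coord e1 e2 x = frame_coord e1 e2 y"
  obtain c where c: "x - y = c *\<^sub>R edge_dir vs i" using edge_diff_span[OF xy(1,2)] by (auto simp: span_singleton)
  have "frame_coord e1 e2 (x - y) = 0" using xy(3) by (simp add: linear_diff[OF frame_coord_linear])
  then have "c = 0" using regular_edge_dir[OF assms] by (simp add: c linear_scale[OF frame_coord_linear])
  then show "x = y" using c by simp
qed

text \<open>
  The definition of a crossing does not tell which of the two given points lies on which edge; exchanging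
  the edges takes care of this, at the price of a sign in the triple product.
\<close>

lemma regular_crossing:
  assumes r: "regular u" and f: "positive_frame u e1 e2"
    and xy: "x \<in> support L" "y \<in> support L" "x \<noteq> y" "frame_coord e1 e2 x = frame_coord e1 e2 y"
  obtains i j where "Suc i < length vs" "Suc j < length vs" "i \<noteq> j" "x \<in> edge vs i" "y \<in> edge vs j"
    "cross3 (edge_dir vs i) (edge_dir vs j) \<bullet> u \<noteq> 0"
    "fibre L u (proj u x) = {x, y}"
    "\<forall>k < length vs. x \<noteq> vs ! k \<and> y \<noteq> vs ! k"
proof -
  have p: "proj u x = proj u y" using xy(4) by (simp add: proj_eq_iff[OF f])
  have fib: "x \<in> fibre L u (proj u x)" "y \<in> fibre L u (proj u x)" using xy p by (auto simp: fibre_def)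
  then have "proj u x \<in> multiple_points L u" using xy(3) unfolding multiple_points_def by blast
  then have "crossing_point vs L u (proj u x)" using r by (simp add: regular_def)
  then obtain i j x' y' where ij: "Suc i < length vs" "Suc j < length vs"
      "x' \<in> open_segment (vs ! i) (vs ! Suc i)" "y' \<in> open_segment (vs ! j) (vs ! Suc j)"
      "x' \<noteq> y'" and eq: "fibre L u (proj u x) = {x', y'}"
      and nc: "cross3 (edge_dir vs i) (edge_dir vs j) \<bullet> u \<noteq> 0"
    unfolding crossing_point_def collinear_projections_iff[OF f] edge_dir_def by blast
  have e: "x' \<in> edge vs i" "y' \<in> edge vs j" using ij by (auto simp: edge_def open_segment_def)
  have nij: "i \<noteq> j" using nc by auto
  have nc': "cross3 (edge_dir vs j) (edge_dir vs i) \<bullet> u \<noteq> 0"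
    using nc cross_skew[of "edge_dir vs j" "edge_dir vs i"] by simp
  have v: "w \<noteq> vs ! k" if "k < length vs" "w \<in> {x, y}" for w k
  proof
    assume "w = vs ! k"
    then have "x = vs ! k" "y = vs ! k"
      using regular_vertex[OF r f that(1), of x] regular_vertex[OF r f that(1), of y] that xy by auto
    then show False using xy(3) by simp
  qed
  have "(x = x' \<and> y = y') \<or> (x = y' \<and> y = x')" using fib xy(3) unfolding eq by auto
  then show ?thesis
  proof
    assume "x = x' \<and> y = y'"
    then show ?thesis using that[of i j] ij(1,2) e nij nc eq v by auto
  next
    assume "x = y' \<and> y = x'"
    then show ?thesis using that[of j i] ij(1,2) e nij nc' eq v by auto
  qed
qed


section \<open>Perturbations that match two projections locally\<close>

text \<open>
  Where the point \<open>v\<close> of the diagram in the direction \<open>u\<^sub>0\<close> may go: to the corresponding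
  vertex if \<open>v\<close> is a vertex image, and otherwise into the lines of all edges whose images contain
  \<open>v\<close>. Lines instead of segments give the freedom to move along the edges, and the sets are convex.
\<close>

definition matching_position :: "real^3 \<Rightarrow> real^3 \<Rightarrow> real^3 \<Rightarrow> complex \<Rightarrow> complex set" where
  "matching_position a u\<^sub>0 u v =
     (\<Inter>i\<in>{i. Suc i < length vs \<and> v \<in> coord a u\<^sub>0 ` edge vs i}.
        coord a u ` (affine hull {vs ! i, vs ! Suc i})) \<inter>
     (\<Inter>k\<in>{k. k < length vs \<and> v = coord a u\<^sub>0 (vs ! k)}. {coord a u (vs ! k)})"

lemma convex_matching_position: "convex (matching_position a u\<^sub>0 u v)"
  unfolding matching_position_def
  by (intro convex_Int convex_INT convex_linear_image frame_coord_linear convex_singleton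
      affine_imp_convex affine_affine_hull)

lemma edge_shift_in_line:
  assumes "x \<in> edge vs i"
  shows "x + t *\<^sub>R edge_dir vs i \<in> affine hull {vs ! i, vs ! Suc i}"
proof -
  obtain s where "x = vs ! i + s *\<^sub>R edge_dir vs i" using edge_param[OF assms] by metis
  then have "x + t *\<^sub>R edge_dir vs i = vs ! i + (s + t) *\<^sub>R (vs ! Suc i - vs ! i)"
    by (simp add: edge_dir_def algebra_simps)
  then show ?thesis unfolding affine_hull_2_alt by blast
qed

text \<open>
  Only edges through \<open>z\<close> matter in a small ball. If \<open>z\<close> has a single preimage \<open>x\<close>, the edges
  through \<open>x\<close> span a subspace that does not contain \<open>u\<^sub>0\<close>, so the ball is lifted to an affine space that
  contains these edges and is projected again in the direction \<open>u\<close>. At a crossing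
  the two edges are skew; the lift contains the edge through \<open>x\<close> and a parallel to the other one. The projected lift is off the image of the second edge by a translation,
  which is corrected by sliding along the first edge.
\<close>

lemma local_perturbation:
  assumes r: "regular u\<^sub>0" and n: "norm u\<^sub>0 = 1" and a: "proj u\<^sub>0 a \<noteq> 0"
    and z: "z \<in> coord a u\<^sub>0 ` support L"
  shows "\<exists>\<rho>>0. \<forall>\<epsilon>>0. \<forall>\<^sub>F u in at u\<^sub>0 within sphere 0 1. \<exists>h. small_perturbation \<epsilon> h \<and>
           (\<forall>v \<in> coord a u\<^sub>0 ` support L \<inter> ball z \<rho>. v + h v \<in> matching_position a u\<^sub>0 u v)"
proof -
  define A where "A = coord a u\<^sub>0"
  have f: "positive_frame u\<^sub>0 (frame1 a u\<^sub>0) (frame2 a u\<^sub>0)" using positive_frame_frame[OF n a] .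
  have linA: "linear A" unfolding A_def by (rule frame_coord_linear)
  obtain x where x: "x \<in> support L" "z = A x" using z by (auto simp: A_def)
  let ?\<C> = "(\<lambda>i. A ` edge vs i) ` {i. Suc i < length vs} \<union> (\<lambda>k. {A (vs ! k)}) ` {..<length vs}"
  have "closed S" if "S \<in> ?\<C>" for S
  proof -
    have "compact (A ` edge vs i)" for i
      using compact_continuous_image[OF linear_continuous_on[of A] compact_edge] linA
      by (simp add: linear_conv_bounded_linear)
    then show ?thesis using that by (auto intro: compact_imp_closed)
  qed
  then obtain \<rho> where \<rho>: "\<rho> > 0" "\<forall>S\<in>?\<C>. S \<inter> ball z \<rho> \<noteq> {} \<longrightarrow> z \<in> S"
    using ball_meets_only_incident[of ?\<C> z] finite_edge_indices by blast
  have near_edge: "z \<in> A ` edge vs i" if "Suc i < length vs" "v \<in> ball z \<rho>" "v \<in> A ` edge vs i" for i v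
  proof -
    have "A ` edge vs i \<in> ?\<C>" using that(1) by simp
    then show ?thesis using bspec[OF \<rho>(2)] that(2,3) by blast
  qed
  have near_vertex: "A (vs ! k) = z" if "k < length vs" "A (vs ! k) \<in> ball z \<rho>" for k
  proof -
    have "{A (vs ! k)} \<in> ?\<C>" using that(1) by simp
    then show ?thesis using bspec[OF \<rho>(2)] that(2) by blast
  qed
  show ?thesis
  proof (intro exI[of _ \<rho>] conjI allI impI \<rho>(1))
    fix \<epsilon> :: real assume \<epsilon>: "0 < \<epsilon>"
    show "\<forall>\<^sub>F u in at u\<^sub>0 within sphere 0 1. \<exists>h. small_perturbation \<epsilon> h \<and>
           (\<forall>v \<in> coord a u\<^sub>0 ` support L \<inter> ball z \<rho>. v + h v \<in> matching_position a u\<^sub>0 u v)"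
    proof (cases "\<exists>y \<in> support L. A y = z \<and> y \<noteq> x")
      case False
      define V where "V = {edge_dir vs i | i. Suc i < length vs \<and> x \<in> edge vs i}"
      have "u\<^sub>0 \<notin> span V" using r unfolding V_def by (simp add: regular_def)
      then obtain g where g: "linear g" "\<And>d. d \<in> span V \<Longrightarrow> g (A d) = d"
        using linear_section_on_span[OF f] unfolding A_def by metis
      have "\<forall>\<^sub>F u in at u\<^sub>0 within sphere 0 1.
          small_perturbation \<epsilon> (\<lambda>v. coord a u (x + g (v - z)) - coord a u\<^sub>0 (x + g (v - z)) + 0)"
        by (rule eventually_small_perturbation_coord[OF a g(1) tendsto_const \<epsilon>])
      then show ?thesis
      proof eventually_elim
        case (elim u)
        let ?h = "\<lambda>v. coord a u (x + g (v - z)) - coord a u\<^sub>0 (x + g (v - z)) + 0"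
        have "v + ?h v \<in> matching_position a u\<^sub>0 u v" if v: "v \<in> ball z \<rho>" for v
          unfolding matching_position_def
        proof (intro IntI INT_I)
          fix i assume "i \<in> {i. Suc i < length vs \<and> v \<in> coord a u\<^sub>0 ` edge vs i}"
          then obtain w where i: "Suc i < length vs" and w: "w \<in> edge vs i" "v = A w"
            by (auto simp: A_def)
          obtain x' where "x' \<in> edge vs i" "z = A x'" using near_edge[OF i v] w by blast
          then have "x \<in> edge vs i" using False edge_subset_support[OF i] by auto
          then have "edge_dir vs i \<in> V" "w - x \<in> span {edge_dir vs i}"
            using i edge_diff_span[OF w(1)] by (auto simp: V_def)
          then have "w - x \<in> span V" using span_mono[of "{edge_dir vs i}" V] by blast
          then have "x + g (v - z) = w" using g(2)[of "w - x"] by (simp add: w x linear_diff[OF linA])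
          then have "v + ?h v = coord a u w" using w by (simp add: A_def)
          then show "v + ?h v \<in> coord a u ` (affine hull {vs ! i, vs ! Suc i})"
            using edge_shift_in_line[OF w(1), of 0] by simp
        next
          fix k assume "k \<in> {k. k < length vs \<and> v = coord a u\<^sub>0 (vs ! k)}"
          then have k: "k < length vs" "v = A (vs ! k)" by (auto simp: A_def)
          then have "v = z" using near_vertex v by auto
          moreover have "vs ! k = x" using False vertex_in_support[OF k(1)] k \<open>v = z\<close> by auto
          ultimately show "v + ?h v \<in> {coord a u (vs ! k)}"
            using x(2) by (simp add: linear_0[OF g(1)] A_def)
        qed
        then show ?case using elim by (intro exI[of _ ?h]) blast
      qed
    next
      case True
      then obtain y where y: "y \<in> support L" "A y = z" "y \<noteq> x" by blast
      have Axy: "A x = A y" using x y by simp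
      obtain i j where ij: "Suc i < length vs" "Suc j < length vs" "i \<noteq> j" "x \<in> edge vs i" "y \<in> edge vs j"
        "cross3 (edge_dir vs i) (edge_dir vs j) \<bullet> u\<^sub>0 \<noteq> 0"
        and fib: "fibre L u\<^sub>0 (proj u\<^sub>0 x) = {x, y}"
        and xyv: "\<forall>k < length vs. x \<noteq> vs ! k \<and> y \<noteq> vs ! k"
        by (rule regular_crossing[OF r f x(1) y(1) y(3)[symmetric] Axy[unfolded A_def]])
      from xyv have xv: "x \<noteq> vs ! k" and yv: "y \<noteq> vs ! k" if "k < length vs" for k
        using that by blast+
      let ?d = "edge_dir vs i" and ?e = "edge_dir vs j"
      have "span {?d, ?e} \<subseteq> {v. cross3 ?d ?e \<bullet> v = 0}"
        by (intro span_minimal subspace_hyperplane) (auto simp: dot_cross_self)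
      then have "u\<^sub>0 \<notin> span {?d, ?e}" using ij(6) by auto
      then obtain g where g: "linear g" "\<And>d. d \<in> span {?d, ?e} \<Longrightarrow> g (A d) = d"
        using linear_section_on_span[OF f] unfolding A_def by metis
      \<comment> \<open>by Cramer's rule, the distance from \<open>x\<close> along the first edge to the new crossing\<close>
      define s where "s u = (cross3 (y - x) ?e \<bullet> u) / (cross3 ?d ?e \<bullet> u)" for u
      have "A (y - x) = 0" using Axy by (simp add: linear_diff[OF linA])
      then obtain c where c: "y - x = c *\<^sub>R u\<^sub>0" unfolding A_def using frame_coord_eq_0_iff[OF f] by blast
      have "(s \<longlongrightarrow> (cross3 (y - x) ?e \<bullet> u\<^sub>0) / (cross3 ?d ?e \<bullet> u\<^sub>0)) (at u\<^sub>0 within sphere 0 1)"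
        unfolding s_def using ij(6) by (intro tendsto_intros)
      then have "(s \<longlongrightarrow> 0) (at u\<^sub>0 within sphere 0 1)"
        by (simp add: c cross_mult_left dot_cross_self)
      then have "((\<lambda>u. s u *\<^sub>R coord a u ?d) \<longlongrightarrow> 0 *\<^sub>R coord a u\<^sub>0 ?d) (at u\<^sub>0 within sphere 0 1)"
        by (intro tendsto_intros tendsto_coord a)
      then have "((\<lambda>u. s u *\<^sub>R coord a u ?d) \<longlongrightarrow> 0) (at u\<^sub>0 within sphere 0 1)" by simp
      then have "\<forall>\<^sub>F u in at u\<^sub>0 within sphere 0 1. small_perturbation \<epsilon>
          (\<lambda>v. coord a u (x + g (v - z)) - coord a u\<^sub>0 (x + g (v - z)) + s u *\<^sub>R coord a u ?d)"
        by (rule eventually_small_perturbation_coord[OF a g(1) _ \<epsilon>])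
      moreover have "((\<lambda>u. cross3 ?d ?e \<bullet> u) \<longlongrightarrow> cross3 ?d ?e \<bullet> u\<^sub>0) (at u\<^sub>0 within sphere 0 1)"
        by (intro tendsto_intros)
      then have "\<forall>\<^sub>F u in at u\<^sub>0 within sphere 0 1. cross3 ?d ?e \<bullet> u \<noteq> 0"
        using ij(6) by (rule tendsto_imp_eventually_ne)
      moreover note eventually_positive_frame[OF a]
      ultimately show ?thesis
      proof eventually_elim
        case (elim u)
        let ?h = "\<lambda>v. coord a u (x + g (v - z)) - coord a u\<^sub>0 (x + g (v - z)) + s u *\<^sub>R coord a u ?d"
        note linu = frame_coord_linear[of "frame1 a u" "frame2 a u"]
        have "v + ?h v \<in> matching_position a u\<^sub>0 u v" if v: "v \<in> ball z \<rho>" for v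
          unfolding matching_position_def
        proof (intro IntI INT_I)
          fix m assume "m \<in> {i. Suc i < length vs \<and> v \<in> coord a u\<^sub>0 ` edge vs i}"
          then obtain w where m: "Suc m < length vs" and w: "w \<in> edge vs m" "v = A w"
            by (auto simp: A_def)
          obtain x' where x': "x' \<in> edge vs m" "z = A x'" using near_edge[OF m v] w by blast
          then have "x' \<in> fibre L u\<^sub>0 (proj u\<^sub>0 x)"
            using edge_subset_support[OF m] x(2) proj_eq_iff[OF f] by (auto simp: fibre_def A_def)
          then consider "x' = x" | "x' = y" unfolding fib by blast
          then show "v + ?h v \<in> coord a u ` (affine hull {vs ! m, vs ! Suc m})"
          proof cases
            case 1
            have mi: "m = i" using edges_meet_vertex[OF m ij(1) _ _ ij(4)] x' 1 xv by metis
            have "w - x \<in> span {?d}" using edge_diff_span[OF w(1)] x' 1 mi by auto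
            then have "w - x \<in> span {?d, ?e}" using span_mono[of "{?d}" "{?d, ?e}"] by blast
            then have "x + g (v - z) = w" using g(2)[of "w - x"] by (simp add: w x linear_diff[OF linA])
            then have "v + ?h v = coord a u (w + s u *\<^sub>R edge_dir vs m)"
              using w by (simp add: A_def mi linear_add[OF linu] linear_scale[OF linu])
            then show ?thesis using edge_shift_in_line[OF w(1)] by blast
          next
            case 2
            have mj: "m = j" using edges_meet_vertex[OF m ij(2) _ _ ij(5)] x' 2 yv by metis
            have wy: "w - y \<in> span {?e}" using edge_diff_span[OF w(1)] x' 2 mj by auto
            then have "w - y \<in> span {?d, ?e}" using span_mono[of "{?e}" "{?d, ?e}"] by blast
            then have gv: "x + g (v - z) = x + (w - y)"
              using g(2)[of "w - y"] y(2) by (simp add: w linear_diff[OF linA])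
            have "coord a u\<^sub>0 (x + (w - y)) = v"
              using Axy w(2) linear_add[OF linA, of x "w - y"] linear_diff[OF linA, of w y]
              by (simp add: A_def)
            then have hv: "v + ?h v = coord a u (x + (w - y)) + s u *\<^sub>R coord a u ?d"
              by (simp add: gv)
            define t where "t = (cross3 ?d (y - x) \<bullet> u) / (cross3 ?d ?e \<bullet> u)"
            have cr: "coord a u (y - x) = s u *\<^sub>R coord a u ?d + t *\<^sub>R coord a u ?e"
              unfolding s_def t_def by (rule frame_coord_Cramer[OF elim(3,2)])
            have "x + (w - y) = w - (y - x)" by simp
            then have "coord a u (x + (w - y)) = coord a u w - coord a u (y - x)"
              by (simp only: linear_diff[OF linu])
            then have "v + ?h v = coord a u (w + (- t) *\<^sub>R edge_dir vs m)"
              unfolding hv cr by (simp add: mj linear_diff[OF linu] linear_scale[OF linu])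
            then show ?thesis using edge_shift_in_line[OF w(1)] by blast
          qed
        next
          fix k assume "k \<in> {k. k < length vs \<and> v = coord a u\<^sub>0 (vs ! k)}"
          then have k: "k < length vs" "v = A (vs ! k)" by (auto simp: A_def)
          then have "A x = A (vs ! k)" using near_vertex v x(2) by metis
          then have "x = vs ! k" using regular_vertex[OF r f k(1) x(1)] by (simp add: A_def)
          then show "v + ?h v \<in> {coord a u (vs ! k)}" using xv k by blast
        qed
        then show ?case using elim by (intro exI[of _ ?h]) blast
      qed
    qed
  qed
qed

end


section \<open>Isomorphisms between diagrams in nearby directions\<close>

text \<open>
  On a compact set an injective continuous map is an embedding, so it carries the punctured germ of the
  set to the punctured germ of its image.
\<close>

lemma filtermap_at_within_embedding:
  fixes f :: "'a::t2_space \<Rightarrow> 'b::t2_space"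
  assumes S: "compact S" and c: "continuous_on S f" and i: "inj_on f S" and x: "x \<in> S"
  shows "filtermap f (at x within S) = at (f x) within f ` S"
proof -
  have le: "filtermap f (at x within S) \<le> at (f x) within f ` S"
    if "continuous_on S f" "inj_on f S" "x \<in> S" for f :: "'c::t2_space \<Rightarrow> 'd::t2_space" and S x
  proof -
    have "filterlim f (at (f x) within f ` S) (at x within S)"
      unfolding filterlim_at
    proof
      show "\<forall>\<^sub>F y in at x within S. f y \<in> f ` S \<and> f y \<noteq> f x"
        using that(2,3) by (auto simp: eventually_at_filter inj_on_eq_iff)
      show "(f \<longlongrightarrow> f x) (at x within S)" using that by (simp add: continuous_on_def)
    qed
    then show ?thesis by (simp add: filterlim_def)
  qed
  obtain g where g: "homeomorphism S (f ` S) f g" using homeomorphism_compact[OF S c refl i] by blast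
  have gf: "g (f y) = y" if "y \<in> S" for y using g that by (auto simp: homeomorphism_def)
  have "inj_on g (f ` S)" by (rule inj_on_inverseI[of _ f]) (simp add: homeomorphism_apply2[OF g])
  then have "filtermap g (at (f x) within f ` S) \<le> at (g (f x)) within g ` f ` S"
    using g x by (intro le) (auto simp: homeomorphism_def)
  moreover have "g ` f ` S = S" using g by (auto simp: homeomorphism_def)
  ultimately have "filtermap f (filtermap g (at (f x) within f ` S)) \<le> filtermap f (at x within S)"
    using gf[OF x] by (intro filtermap_mono) simp
  moreover have "filtermap f (filtermap g (at (f x) within f ` S)) = at (f x) within f ` S"
    by (rule filtermap_inverse[OF _ refl]) (simp add: eventually_at_filter homeomorphism_apply2[OF g])
  ultimately show ?thesis using le[OF c i x] by (intro antisym) auto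
qed

lemma upper_lower_point_eq:
  assumes "fibre L u p = {x, y}" "y \<bullet> u < x \<bullet> u"
  shows "upper_point L u p = x" "lower_point L u p = y"
proof -
  have "is_arg_max (\<lambda>w. w \<bullet> u) (\<lambda>w. w \<in> {x, y}) w \<longleftrightarrow> w = x" for w
    using assms(2) by (auto simp: is_arg_max_linorder)
  then show "upper_point L u p = x"
    by (simp add: upper_point_def arg_max_on_def arg_max_def assms(1))
  have "is_arg_min (\<lambda>w. w \<bullet> u) (\<lambda>w. w \<in> {x, y}) w \<longleftrightarrow> w = y" for w
    using assms(2) by (auto simp: is_arg_min_linorder)
  then show "lower_point L u p = y"
    by (simp add: lower_point_def arg_min_on_def arg_min_def assms(1))
qed

context polygonal_arc
begin

text \<open>
  Away from the vertices the germ of the arc is the germ of a single edge.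
\<close>

lemma at_within_support:
  assumes "Suc i < length vs" "x \<in> edge vs i" "\<forall>k < length vs. x \<noteq> vs ! k"
  shows "at x within support L = at x within edge vs i"
proof (rule at_within_nhd)
  let ?C = "\<Union>j\<in>{j. Suc j < length vs} - {i}. edge vs j"
  have "closed ?C" using finite_edge_indices by (intro closed_UN closed_edge ballI) auto
  then show "open (- ?C)" by (rule open_Compl)
  show "x \<in> - ?C" using edges_meet_vertex[OF assms(1) _ _ assms(2)] assms(3) by blast
  show "support L \<inter> - ?C - {x} = edge vs i \<inter> - ?C - {x}"
    using assms(1) unfolding support_eq by auto
qed

end

lemma multiple_pointE:
  assumes "positive_frame w a b" "p \<in> multiple_points L w"
  obtains x y where "x \<in> support L" "y \<in> support L" "x \<noteq> y" "frame_coord a b x = frame_coord a b y"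
    "y \<bullet> w \<le> x \<bullet> w" "p = proj w x"
proof -
  obtain x y where xy: "x \<in> fibre L w p" "y \<in> fibre L w p" "x \<noteq> y"
    using assms(2) unfolding multiple_points_def by blast
  then have *: "x \<in> support L" "y \<in> support L" "proj w x = p" "proj w y = p" by (auto simp: fibre_def)
  then have c: "frame_coord a b x = frame_coord a b y" using proj_eq_iff[OF assms(1), of x y] by simp
  show ?thesis
  proof (cases "y \<bullet> w \<le> x \<bullet> w")
    case True
    then show ?thesis using that[of x y] * c xy(3) by auto
  next
    case False
    then show ?thesis using that[of y x] * c xy(3) by auto
  qed
qed

text \<open>
  The outcome of the local construction: a single perturbation \<open>h\<close> for the whole diagram.
  The last assumption holds for \<open>u\<close> close to \<open>u\<^sub>0\<close>, and it prevents the two strands at a crossing from being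
  exchanged.
\<close>

locale perturbed_projection = polygonal_arc +
  fixes u\<^sub>0 u e1 e2 e1' e2' :: "real^3" and h :: "complex \<Rightarrow> complex"
  assumes regular\<^sub>0: "regular u\<^sub>0" and regular: "regular u"
    and frame\<^sub>0: "positive_frame u\<^sub>0 e1 e2" and frame: "positive_frame u e1' e2'"
    and small: "small_perturbation (1/2) h"
    and on_line: "\<And>i x. \<lbrakk>Suc i < length vs; x \<in> edge vs i\<rbrakk> \<Longrightarrow>
        frame_coord e1 e2 x + h (frame_coord e1 e2 x) \<in> frame_coord e1' e2' ` (affine hull {vs ! i, vs ! Suc i})"
    and on_vertex: "\<And>k. k < length vs \<Longrightarrow>
        frame_coord e1 e2 (vs ! k) + h (frame_coord e1 e2 (vs ! k)) = frame_coord e1' e2' (vs ! k)"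
    and same_sign: "\<And>i j. \<lbrakk>Suc i < length vs; Suc j < length vs; cross3 (edge_dir vs i) (edge_dir vs j) \<bullet> u\<^sub>0 \<noteq> 0\<rbrakk>
        \<Longrightarrow> 0 < (cross3 (edge_dir vs i) (edge_dir vs j) \<bullet> u\<^sub>0) * (cross3 (edge_dir vs i) (edge_dir vs j) \<bullet> u)"
begin

abbreviation "A \<equiv> frame_coord e1 e2"
abbreviation "B \<equiv> frame_coord e1' e2'"

definition displace :: "complex \<Rightarrow> complex" where "displace v = v + h v"

lemma homeomorphism_displace: obtains G where "homeomorphism UNIV UNIV displace G"
  using homeomorphism_perturbed_identity[OF small] unfolding displace_def[abs_def, symmetric] .

lemma displace_inj: "displace v = displace w \<longleftrightarrow> v = w"
  by (rule homeomorphism_displace) (metis homeomorphism_apply1 UNIV_I)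

lemma continuous_on_displace: "continuous_on S displace"
  by (rule homeomorphism_displace) (metis homeomorphism_cont1 continuous_on_subset subset_UNIV)

lemma continuous_on_coords: "continuous_on S A" "continuous_on S B"
  by (auto intro!: linear_continuous_on frame_coord_linear simp flip: linear_conv_bounded_linear)

lemma inj_on_displaced_edge: "Suc i < length vs \<Longrightarrow> inj_on (\<lambda>x. displace (A x)) (edge vs i)"
  using regular_inj_on_edge[OF regular\<^sub>0 frame\<^sub>0] by (simp add: inj_on_def displace_inj)

text \<open>
  Along an edge the displaced point has a single coordinate \<open>\<phi>\<close> on the target line. It is continuous and
  injective, and it takes the values \<open>0\<close> and \<open>1\<close> at the end points, so it runs through the interval exactly.
\<close>

lemma edge_image:
  assumes i: "Suc i < length vs"
  shows "(\<lambda>x. displace (A x)) ` edge vs i = B ` edge vs i"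
proof -
  define b where "b = B (vs ! i)"
  define d where "d = B (edge_dir vs i)"
  have d: "d \<noteq> 0" unfolding d_def by (rule regular_edge_dir[OF regular frame i])
  define \<phi> where "\<phi> x = ((displace (A x) - b) \<bullet> d) / (d \<bullet> d)" for x
  have line: "B ` (affine hull {vs ! i, vs ! Suc i}) = range (\<lambda>t. b + t *\<^sub>R d)"
    unfolding affine_hull_2_alt image_image
    by (simp add: b_def d_def edge_dir_def linear_add[OF frame_coord_linear] linear_scale[OF frame_coord_linear])
  have \<phi>: "displace (A x) = b + \<phi> x *\<^sub>R d" if x: "x \<in> edge vs i" for x
  proof -
    obtain t where "displace (A x) = b + t *\<^sub>R d" using on_line[OF i x] unfolding line displace_def by blast
    then show ?thesis using d by (simp add: \<phi>_def)
  qed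
  have "displace (A (vs ! i)) = b" using on_vertex[of i] i by (simp add: displace_def b_def)
  then have \<phi>0: "\<phi> (vs ! i) = 0" by (simp add: \<phi>_def)
  have "displace (A (vs ! Suc i)) = b + d"
    using on_vertex[of "Suc i"] i
    by (simp add: displace_def b_def d_def edge_dir_def linear_diff[OF frame_coord_linear])
  then have \<phi>1: "\<phi> (vs ! Suc i) = 1" using d by (simp add: \<phi>_def)
  have "inj_on \<phi> (edge vs i)"
    using inj_on_displaced_edge[OF i] \<phi> unfolding inj_on_def by metis
  moreover have "continuous_on (edge vs i) \<phi>"
    unfolding \<phi>_def using d
    by (intro continuous_intros continuous_on_compose2[OF continuous_on_displace continuous_on_coords(1)]) auto
  ultimately have "\<phi> ` edge vs i = {0..1}"
    using continuous_injective_image_segment_1[of "vs ! i" "vs ! Suc i" \<phi>] \<phi>0 \<phi>1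
    by (simp add: edge_def closed_segment_eq_real_ivl)
  then have "(\<lambda>x. displace (A x)) ` edge vs i = (\<lambda>t. b + t *\<^sub>R d) ` {0..1}"
    using \<phi> by (metis (no_types, lifting) image_cong image_image)
  also have "\<dots> = B ` (\<lambda>t. vs ! i + t *\<^sub>R edge_dir vs i) ` {0..1}"
    unfolding image_image
    by (simp add: b_def d_def linear_add[OF frame_coord_linear] linear_scale[OF frame_coord_linear])
  also have "(\<lambda>t. vs ! i + t *\<^sub>R edge_dir vs i) ` {0..1} = edge vs i"
    by (simp add: edge_def closed_segment_image_interval edge_dir_def algebra_simps)
  finally show ?thesis .
qed

lemma edge_match:
  assumes "Suc i < length vs" "x \<in> edge vs i"
  obtains x' where "x' \<in> edge vs i" "B x' = displace (A x)"
proof -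
  have "displace (A x) \<in> (\<lambda>x. displace (A x)) ` edge vs i" using assms(2) by (rule imageI)
  then show ?thesis unfolding edge_image[OF assms(1)] using that by (metis imageE)
qed

lemma edge_match_reverse:
  assumes "Suc i < length vs" "x' \<in> edge vs i"
  obtains x where "x \<in> edge vs i" "displace (A x) = B x'"
proof -
  have "B x' \<in> B ` edge vs i" using assms(2) by (rule imageI)
  then show ?thesis unfolding edge_image[OF assms(1), symmetric] using that by (metis imageE)
qed

lemma support_image: "(\<lambda>x. displace (A x)) ` support L = B ` support L"
  unfolding support_eq image_UN using edge_image by simp

text \<open>
  Two different edges of the arc share at most a vertex, and vertices are matched with vertices. Hence a
  coincidence of two edges in the plane is a crossing in one direction iff it is one in the other.
\<close>

lemma distinct_match:
  assumes ij: "Suc i < length vs" "Suc j < length vs" "i \<noteq> j"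
    and e: "x \<in> edge vs i" "y \<in> edge vs j" "x' \<in> edge vs i" "y' \<in> edge vs j"
    and m: "B x' = displace (A x)" "B y' = displace (A y)" and eq: "A x = A y"
  shows "x = y \<longleftrightarrow> x' = y'"
proof -
  have sup: "x \<in> support L" "y \<in> support L" "x' \<in> support L" "y' \<in> support L"
    using e edge_subset_support ij by blast+
  show ?thesis
  proof
    assume "x = y"
    then obtain k where k: "k < length vs" "x = vs ! k" using edges_meet_vertex[OF ij e(1)] e(2) by auto
    then have "B x' = B (vs ! k)" "B y' = B (vs ! k)"
      using m eq on_vertex[OF k(1)] by (simp_all add: displace_def)
    then show "x' = y'" using regular_vertex[OF regular frame k(1)] sup by metis
  next
    assume "x' = y'"
    then obtain k where k: "k < length vs" "x' = vs ! k" using edges_meet_vertex[OF ij e(3)] e(4) by auto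
    then have "displace (A x) = displace (A (vs ! k))"
      using m on_vertex[OF k(1)] by (simp add: displace_def)
    then have "A x = A (vs ! k)" "A y = A (vs ! k)" using eq by (simp_all add: displace_inj)
    then show "x = y" using regular_vertex[OF regular\<^sub>0 frame\<^sub>0 k(1)] sup by metis
  qed
qed

text \<open>
  The vector between the two strands is a multiple of the projection direction. Its triple product with the
  edge directions does not depend on where on the two edges it is taken, so it is the same for both
  directions; thus the sign of the multiple changes only when the triple product of the edge directions
  with the projection direction does.
\<close>

lemma height_sign:
  assumes ij: "Suc i < length vs" "Suc j < length vs"
    and c: "cross3 (edge_dir vs i) (edge_dir vs j) \<bullet> u\<^sub>0 \<noteq> 0"
    and e: "x \<in> edge vs i" "y \<in> edge vs j" "x' \<in> edge vs i" "y' \<in> edge vs j"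
    and eq: "A x = A y" "B x' = B y'"
  shows "y \<bullet> u\<^sub>0 \<le> x \<bullet> u\<^sub>0 \<longleftrightarrow> y' \<bullet> u \<le> x' \<bullet> u"
    and "x \<noteq> y \<Longrightarrow> x \<bullet> u\<^sub>0 \<noteq> y \<bullet> u\<^sub>0" and "x' \<noteq> y' \<Longrightarrow> x' \<bullet> u \<noteq> y' \<bullet> u"
proof -
  let ?n = "cross3 (edge_dir vs i) (edge_dir vs j)"
  have "A (x - y) = 0" "B (x' - y') = 0" using eq by (simp_all add: linear_diff[OF frame_coord_linear])
  then obtain m m' where l: "x - y = m *\<^sub>R u\<^sub>0" "x' - y' = m' *\<^sub>R u"
    using frame_coord_eq_0_iff[OF frame\<^sub>0] frame_coord_eq_0_iff[OF frame] by metis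
  have "norm u\<^sub>0 = 1" "norm u = 1"
    by (rule frame_coord_lemmas(1)[OF frame\<^sub>0], rule frame_coord_lemmas(1)[OF frame])
  then have "(x - y) \<bullet> u\<^sub>0 = m" "(x' - y') \<bullet> u = m'" by (simp_all add: l norm_eq_1)
  then have h: "x \<bullet> u\<^sub>0 - y \<bullet> u\<^sub>0 = m" "x' \<bullet> u - y' \<bullet> u = m'" by (simp_all add: inner_diff_left)
  have const: "?n \<bullet> (p - q) = ?n \<bullet> (vs ! i - vs ! j)" if pq: "p \<in> edge vs i" "q \<in> edge vs j" for p q
  proof -
    obtain s t where "p = vs ! i + s *\<^sub>R edge_dir vs i" "q = vs ! j + t *\<^sub>R edge_dir vs j"
      using edge_param pq by metis
    then show ?thesis by (simp add: inner_diff_right inner_add_right dot_cross_self)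
  qed
  \<comment> \<open>both sides are the triple product of the edge directions with a vector between the edges\<close>
  have eq: "m * (?n \<bullet> u\<^sub>0) = m' * (?n \<bullet> u)"
    using const[OF e(1,2)] const[OF e(3,4)] by (simp add: l)
  have pos: "0 < (?n \<bullet> u\<^sub>0) * (?n \<bullet> u)" by (rule same_sign[OF ij c])
  have "0 \<le> m \<longleftrightarrow> 0 \<le> m'"
    using eq pos by (smt (verit) zero_less_mult_iff zero_le_mult_iff)
  then show "y \<bullet> u\<^sub>0 \<le> x \<bullet> u\<^sub>0 \<longleftrightarrow> y' \<bullet> u \<le> x' \<bullet> u" using h by linarith
  show "x \<noteq> y \<Longrightarrow> x \<bullet> u\<^sub>0 \<noteq> y \<bullet> u\<^sub>0" using h l by auto
  show "x' \<noteq> y' \<Longrightarrow> x' \<bullet> u \<noteq> y' \<bullet> u" using h l by auto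
qed

definition diagram_map :: "real^3 \<Rightarrow> real^3" where
  "diagram_map x = frame_point e1' e2' (displace (A x))"

lemma diagram_map_proj: "diagram_map (proj u\<^sub>0 x) = frame_point e1' e2' (displace (A x))"
  by (simp add: diagram_map_def frame_coord_proj[OF frame\<^sub>0])

lemma diagram_map_proj_match: "B x' = displace (A x) \<Longrightarrow> diagram_map (proj u\<^sub>0 x) = proj u x'"
  by (simp add: diagram_map_proj proj_eq_frame_point[OF frame])

lemma homeomorphism_diagram_map: "\<exists>g. homeomorphism (plane u\<^sub>0) (plane u) diagram_map g"
proof -
  obtain G where G: "homeomorphism UNIV UNIV displace G" by (rule homeomorphism_displace)
  have fp: "continuous_on S (frame_point a b)" for S a b
    unfolding frame_point_def by (intro continuous_intros)
  have cG: "continuous_on S G" for S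
    using homeomorphism_cont2[OF G] continuous_on_subset by blast
  have GF: "G (displace v) = v" "displace (G v) = v" for v using G by (auto simp: homeomorphism_def)
  show ?thesis
  proof (intro exI homeomorphismI)
    show "continuous_on (plane u\<^sub>0) diagram_map" unfolding diagram_map_def
      by (intro continuous_on_compose2[OF fp] continuous_on_compose2[OF continuous_on_displace]
          continuous_on_coords) auto
    show "continuous_on (plane u) (\<lambda>y. frame_point e1 e2 (G (B y)))"
      by (intro continuous_on_compose2[OF fp] continuous_on_compose2[OF cG]
          continuous_on_coords) auto
  qed (auto simp: diagram_map_def frame_point_in_plane[OF frame] frame_point_in_plane[OF frame\<^sub>0]
      frame_coord_frame_point[OF frame] frame_coord_frame_point[OF frame\<^sub>0] GF
      frame_point_frame_coord[OF frame] frame_point_frame_coord[OF frame\<^sub>0])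
qed

lemma orientation_preserving_diagram_map: "orientation_preserving_map u\<^sub>0 u diagram_map"
  unfolding orientation_preserving_map_def
proof (intro allI impI, elim conjE)
  fix a1 a2 b1 b2 z and \<gamma> :: "real \<Rightarrow> real^3"
  assume fr: "positive_frame u\<^sub>0 a1 a2" "positive_frame u b1 b2" and z: "z \<in> plane u\<^sub>0"
    and l: "path \<gamma>" "pathfinish \<gamma> = pathstart \<gamma>" "path_image \<gamma> \<subseteq> plane u\<^sub>0 - {z}"
  obtain g where g: "homeomorphism (plane u\<^sub>0) (plane u) diagram_map g" using homeomorphism_diagram_map by blast
  note fl = loop_image_homeomorphism[OF g z l]
  have BF: "B (diagram_map x) = displace (A x)" for x by (simp add: diagram_map_def frame_coord_frame_point[OF frame])
  have "winding_number (frame_coord b1 b2 \<circ> (diagram_map \<circ> \<gamma>)) (frame_coord b1 b2 (diagram_map z))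
      = winding_number (B \<circ> (diagram_map \<circ> \<gamma>)) (B (diagram_map z))"
    by (rule winding_number_frame_coord[OF frame fr(2) fl(4,1,2,3)])
  also have "\<dots> = winding_number (\<lambda>t. (A \<circ> \<gamma>) t + h ((A \<circ> \<gamma>) t)) (A z + h (A z))"
    by (simp add: o_def BF displace_def)
  also have "\<dots> = winding_number (A \<circ> \<gamma>) (A z)"
  proof (rule winding_number_perturbed_identity[OF small])
    show "path (A \<circ> \<gamma>)" by (intro path_continuous_image l continuous_on_coords)
    show "pathfinish (A \<circ> \<gamma>) = pathstart (A \<circ> \<gamma>)" using l(2) by (simp add: pathfinish_def pathstart_def)
    show "A z \<notin> path_image (A \<circ> \<gamma>)"
    proof
      assume "A z \<in> path_image (A \<circ> \<gamma>)"
      then obtain w where w: "w \<in> path_image \<gamma>" "A z = A w" by (auto simp: path_image_compose)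
      then have "w \<in> plane u\<^sub>0" "w \<noteq> z" using l(3) by auto
      then show False using w(2) z frame_point_frame_coord[OF frame\<^sub>0] by metis
    qed
  qed
  also have "\<dots> = winding_number (frame_coord a1 a2 \<circ> \<gamma>) (frame_coord a1 a2 z)"
    by (rule winding_number_frame_coord[OF fr(1) frame\<^sub>0 z l])
  finally show "winding_number (frame_coord b1 b2 \<circ> diagram_map \<circ> \<gamma>) (frame_coord b1 b2 (diagram_map z)) =
        winding_number (frame_coord a1 a2 \<circ> \<gamma>) (frame_coord a1 a2 z)"
    by (simp add: o_assoc)
qed

text \<open>
  Both germs are germs of a single edge, and the images of this edge are carried to each other.
\<close>

lemma strand_match:
  assumes i: "Suc i < length vs" and e: "x \<in> edge vs i" "x' \<in> edge vs i" and m: "B x' = displace (A x)"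
    and nv: "\<forall>k < length vs. x \<noteq> vs ! k" "\<forall>k < length vs. x' \<noteq> vs ! k"
  shows "filtermap diagram_map (filtermap (proj u\<^sub>0) (at x within support L)) = filtermap (proj u) (at x' within support L)"
proof -
  have "filtermap (\<lambda>x. displace (A x)) (at x within edge vs i) = at (displace (A x)) within (\<lambda>x. displace (A x)) ` edge vs i"
    by (intro filtermap_at_within_embedding compact_edge inj_on_displaced_edge i e
        continuous_on_compose2[OF continuous_on_displace continuous_on_coords(1)]) auto
  also have "\<dots> = at (B x') within B ` edge vs i" by (simp add: edge_image[OF i] m)
  also have "\<dots> = filtermap B (at x' within edge vs i)"
    by (intro filtermap_at_within_embedding[symmetric] compact_edge e
        regular_inj_on_edge[OF regular frame i] continuous_on_coords)
  finally have "filtermap (frame_point e1' e2') (filtermap (\<lambda>x. displace (A x)) (at x within edge vs i))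
      = filtermap (frame_point e1' e2') (filtermap B (at x' within edge vs i))" by simp
  then show ?thesis
    by (simp add: filtermap_filtermap diagram_map_proj proj_eq_frame_point[OF frame, abs_def]
        at_within_support[OF i e(1) nv(1)] at_within_support[OF i e(2) nv(2)])
qed

lemma crossing_match:
  assumes xy: "x \<in> support L" "y \<in> support L" "x \<noteq> y" "A x = A y" and le: "y \<bullet> u\<^sub>0 \<le> x \<bullet> u\<^sub>0"
  shows "diagram_map (proj u\<^sub>0 x) \<in> multiple_points L u"
    "filtermap diagram_map (filtermap (proj u\<^sub>0) (at (upper_point L u\<^sub>0 (proj u\<^sub>0 x)) within support L))
       = filtermap (proj u) (at (upper_point L u (diagram_map (proj u\<^sub>0 x))) within support L)"
    "filtermap diagram_map (filtermap (proj u\<^sub>0) (at (lower_point L u\<^sub>0 (proj u\<^sub>0 x)) within support L))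
       = filtermap (proj u) (at (lower_point L u (diagram_map (proj u\<^sub>0 x))) within support L)"
proof -
  obtain i j where ij: "Suc i < length vs" "Suc j < length vs" "i \<noteq> j" "x \<in> edge vs i" "y \<in> edge vs j"
    and c: "cross3 (edge_dir vs i) (edge_dir vs j) \<bullet> u\<^sub>0 \<noteq> 0"
    and fib: "fibre L u\<^sub>0 (proj u\<^sub>0 x) = {x, y}"
    and nv: "\<forall>k < length vs. x \<noteq> vs ! k \<and> y \<noteq> vs ! k"
    by (rule regular_crossing[OF regular\<^sub>0 frame\<^sub>0 xy])
  obtain x' where x': "x' \<in> edge vs i" "B x' = displace (A x)" by (rule edge_match[OF ij(1,4)])
  obtain y' where y': "y' \<in> edge vs j" "B y' = displace (A y)" by (rule edge_match[OF ij(2,5)])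
  have ne: "x' \<noteq> y'" using distinct_match[OF ij x'(1) y'(1) x'(2) y'(2) xy(4)] xy(3) by simp
  have B: "B x' = B y'" using x' y' xy(4) by simp
  have sup: "x' \<in> support L" "y' \<in> support L" using x' y' ij edge_subset_support by blast+
  have "fibre L u (proj u x') = {x', y'} \<and> (\<forall>k < length vs. x' \<noteq> vs ! k \<and> y' \<noteq> vs ! k)"
    by (rule regular_crossing[OF regular frame sup ne B]) blast
  then have fib': "fibre L u (proj u x') = {x', y'}"
    and nv': "\<forall>k < length vs. x' \<noteq> vs ! k \<and> y' \<noteq> vs ! k"
    by blast+
  have fx: "diagram_map (proj u\<^sub>0 x) = proj u x'" by (rule diagram_map_proj_match[OF x'(2)])
  have "x' \<in> fibre L u (proj u x')" "y' \<in> fibre L u (proj u x')" unfolding fib' by auto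
  then show "diagram_map (proj u\<^sub>0 x) \<in> multiple_points L u" using ne unfolding fx multiple_points_def by blast
  note hs = height_sign[OF ij(1,2) c ij(4,5) x'(1) y'(1) xy(4) B]
  have "y \<bullet> u\<^sub>0 < x \<bullet> u\<^sub>0" "y' \<bullet> u < x' \<bullet> u" using hs xy(3) ne le by auto
  note ul = upper_lower_point_eq[OF fib this(1)] upper_lower_point_eq[OF fib' this(2)]
  show "filtermap diagram_map (filtermap (proj u\<^sub>0) (at (upper_point L u\<^sub>0 (proj u\<^sub>0 x)) within support L))
       = filtermap (proj u) (at (upper_point L u (diagram_map (proj u\<^sub>0 x))) within support L)"
    unfolding fx ul using strand_match[OF ij(1,4) x'] nv nv' by blast
  show "filtermap diagram_map (filtermap (proj u\<^sub>0) (at (lower_point L u\<^sub>0 (proj u\<^sub>0 x)) within support L))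
       = filtermap (proj u) (at (lower_point L u (diagram_map (proj u\<^sub>0 x))) within support L)"
    unfolding fx ul using strand_match[OF ij(2,5) y'] nv nv' by blast
qed

lemma crossings_image: "diagram_map ` multiple_points L u\<^sub>0 = multiple_points L u"
proof (rule subset_antisym; rule subsetI)
  fix q assume "q \<in> diagram_map ` multiple_points L u\<^sub>0"
  then obtain p where p: "p \<in> multiple_points L u\<^sub>0" "q = diagram_map p" by blast
  from multiple_pointE[OF frame\<^sub>0 p(1)] show "q \<in> multiple_points L u"
    using crossing_match(1) p(2) by metis
next
  fix q assume "q \<in> multiple_points L u"
  then obtain x' y' where x'y': "x' \<in> support L" "y' \<in> support L" "x' \<noteq> y'" "B x' = B y'" "q = proj u x'"
    using multiple_pointE[OF frame] by metis
  obtain i j where ij: "Suc i < length vs" "Suc j < length vs" "i \<noteq> j" "x' \<in> edge vs i" "y' \<in> edge vs j"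
    by (rule regular_crossing[OF regular frame x'y'(1-4)]) (rule that)
  obtain x where x: "x \<in> edge vs i" "displace (A x) = B x'" by (rule edge_match_reverse[OF ij(1,4)])
  obtain y where y: "y \<in> edge vs j" "displace (A y) = B y'" by (rule edge_match_reverse[OF ij(2,5)])
  have "displace (A x) = displace (A y)" using x(2) y(2) x'y'(4) by simp
  then have A: "A x = A y" by (simp only: displace_inj)
  have "x \<noteq> y" using distinct_match[OF ij(1-3) x(1) y(1) ij(4,5) x(2)[symmetric] y(2)[symmetric] A] x'y'(3) by simp
  moreover have "x \<in> fibre L u\<^sub>0 (proj u\<^sub>0 x)" "y \<in> fibre L u\<^sub>0 (proj u\<^sub>0 x)"
    using x(1) y(1) ij edge_subset_support A proj_eq_iff[OF frame\<^sub>0] by (auto simp: fibre_def)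
  ultimately have "proj u\<^sub>0 x \<in> multiple_points L u\<^sub>0" unfolding multiple_points_def by blast
  moreover have "diagram_map (proj u\<^sub>0 x) = q" using diagram_map_proj_match[OF x(2)[symmetric]] x'y'(5) by simp
  ultimately show "q \<in> diagram_map ` multiple_points L u\<^sub>0" by blast
qed

lemma diagram_isomorphism_diagram_map:
  "diagram_isomorphism (projection_image L u\<^sub>0) (projection_image L u) diagram_map"
proof -
  have diag: "diagram_map ` proj u\<^sub>0 ` support L = proj u ` support L"
  proof -
    have "diagram_map ` proj u\<^sub>0 ` support L = frame_point e1' e2' ` (\<lambda>x. displace (A x)) ` support L"
      by (simp add: image_image diagram_map_proj)
    also have "\<dots> = proj u ` support L"
      by (simp add: support_image image_image proj_eq_frame_point[OF frame])
    finally show ?thesis .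
  qed
  have "B (vs ! k) = displace (A (vs ! k))" if "k < length vs" for k
    using on_vertex[OF that] by (simp add: displace_def)
  note v = diagram_map_proj_match[OF this]
  have "0 < length vs" "length vs - 1 < length vs" using length_vs by auto
  then have pts: "diagram_map (proj u\<^sub>0 (init_pt L)) = proj u (init_pt L)"
    "diagram_map (proj u\<^sub>0 (term_pt L)) = proj u (term_pt L)"
    unfolding init_pt_eq term_pt_eq by (auto intro: v)
  have strands: "filtermap diagram_map (filtermap (proj u\<^sub>0) (at (upper_point L u\<^sub>0 p) within support L))
       = filtermap (proj u) (at (upper_point L u (diagram_map p)) within support L) \<and>
     filtermap diagram_map (filtermap (proj u\<^sub>0) (at (lower_point L u\<^sub>0 p) within support L))
       = filtermap (proj u) (at (lower_point L u (diagram_map p)) within support L)"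
    if p0: "p \<in> multiple_points L u\<^sub>0" for p
  proof -
    obtain x y where "x \<in> support L" "y \<in> support L" "x \<noteq> y" "A x = A y"
      "y \<bullet> u\<^sub>0 \<le> x \<bullet> u\<^sub>0" and p: "p = proj u\<^sub>0 x"
      by (rule multiple_pointE[OF frame\<^sub>0 p0])
    from crossing_match(2,3)[OF this(1-5)] show ?thesis unfolding p by blast
  qed
  show ?thesis
    unfolding diagram_isomorphism_def projection_image_def arc_diagram.simps
    by (intro conjI ballI homeomorphism_diagram_map orientation_preserving_diagram_map diag crossings_image pts
        conjunct1[OF strands] conjunct2[OF strands])
qed

end

context polygonal_arc
begin

text \<open>
  All conditions on the perturbation are met for \<open>u\<close> close to \<open>u\<^sub>0\<close>, and there are only finitely many pairs of
  edges whose orientation has to be kept.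
\<close>

lemma eventually_isomorphic:
  assumes r: "regular u\<^sub>0" and n: "norm u\<^sub>0 = 1"
  shows "\<forall>\<^sub>F u in at u\<^sub>0 within sphere 0 1. regular u \<longrightarrow>
           (\<exists>f. diagram_isomorphism (projection_image L u\<^sub>0) (projection_image L u) f)"
proof -
  obtain a where a: "a \<noteq> 0" "orthogonal u\<^sub>0 a" using orthogonal_to_vector_exists[of u\<^sub>0] by auto
  then have pa: "proj u\<^sub>0 a \<noteq> 0" by (simp add: proj_def orthogonal_def inner_commute)
  let ?D = "coord a u\<^sub>0 ` support L"
  have "compact ?D"
    using compact_continuous_image[OF linear_continuous_on compact_support] frame_coord_linear
    by (metis linear_conv_bounded_linear)
  then have "\<forall>\<^sub>F u in at u\<^sub>0 within sphere 0 1. \<exists>h. small_perturbation (1/2) h \<and>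
               (\<forall>v \<in> ?D. v + h v \<in> matching_position a u\<^sub>0 u v)"
    by (rule small_perturbation_local_to_global[OF _ convex_matching_position local_perturbation[OF r n pa]])
      auto
  moreover have "\<forall>\<^sub>F u in at u\<^sub>0 within sphere 0 1. positive_frame u (frame1 a u) (frame2 a u)"
    by (rule eventually_positive_frame[OF pa])
  moreover
  let ?c = "\<lambda>i j u. cross3 (edge_dir vs i) (edge_dir vs j) \<bullet> u"
  have "\<forall>\<^sub>F u in at u\<^sub>0 within sphere 0 1. ?c i j u\<^sub>0 \<noteq> 0 \<longrightarrow> 0 < ?c i j u\<^sub>0 * ?c i j u" for i j
  proof (cases "?c i j u\<^sub>0 = 0")
    case False
    have "((\<lambda>u. ?c i j u\<^sub>0 * ?c i j u) \<longlongrightarrow> ?c i j u\<^sub>0 * ?c i j u\<^sub>0) (at u\<^sub>0 within sphere 0 1)"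
      by (intro tendsto_intros)
    moreover have "0 < ?c i j u\<^sub>0 * ?c i j u\<^sub>0" using False by (metis not_real_square_gt_zero)
    ultimately have "\<forall>\<^sub>F u in at u\<^sub>0 within sphere 0 1. 0 < ?c i j u\<^sub>0 * ?c i j u"
      by (rule order_tendstoD)
    then show ?thesis by eventually_elim simp
  qed simp
  then have "\<forall>\<^sub>F u in at u\<^sub>0 within sphere 0 1. \<forall>i\<in>{..<length vs}. \<forall>j\<in>{..<length vs}.
      ?c i j u\<^sub>0 \<noteq> 0 \<longrightarrow> 0 < ?c i j u\<^sub>0 * ?c i j u"
    by (intro eventually_ball_finite ballI finite_lessThan)
  ultimately show ?thesis
  proof eventually_elim
    case (elim u)
    then obtain h where h: "small_perturbation (1/2) h"
      "\<And>v. v \<in> ?D \<Longrightarrow> v + h v \<in> matching_position a u\<^sub>0 u v" by blast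
    show ?case
    proof
      assume ru: "regular u"
      interpret perturbed_projection vs L u\<^sub>0 u "frame1 a u\<^sub>0" "frame2 a u\<^sub>0" "frame1 a u" "frame2 a u" h
      proof unfold_locales
        fix i x assume "Suc i < length vs" "x \<in> edge vs i"
        then show "coord a u\<^sub>0 x + h (coord a u\<^sub>0 x) \<in> coord a u ` (affine hull {vs ! i, vs ! Suc i})"
          using h(2)[of "coord a u\<^sub>0 x"] edge_subset_support[of i] unfolding matching_position_def by blast
      next
        fix k assume "k < length vs"
        then show "coord a u\<^sub>0 (vs ! k) + h (coord a u\<^sub>0 (vs ! k)) = coord a u (vs ! k)"
          using h(2)[of "coord a u\<^sub>0 (vs ! k)"] vertex_in_support[of k] unfolding matching_position_def by blast
      next
        fix i j assume "Suc i < length vs" "Suc j < length vs" "?c i j u\<^sub>0 \<noteq> 0"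
        then show "0 < ?c i j u\<^sub>0 * ?c i j u" using elim(3) by auto
      qed (use r ru h(1) elim(2) positive_frame_frame[OF n pa] in auto)
      show "\<exists>f. diagram_isomorphism (projection_image L u\<^sub>0) (projection_image L u) f"
        using diagram_isomorphism_diagram_map by blast
    qed
  qed
qed

end


section \<open>Zeros of polynomials along lines\<close>

lemma finite_zeros_on_line:
  fixes f :: "'a::real_normed_vector \<Rightarrow> real"
  assumes f: "real_polynomial_function f" and nz: "f (x + t\<^sub>0 *\<^sub>R d) \<noteq> 0"
  shows "finite {t. f (x + t *\<^sub>R d) = 0}"
proof -
  have "polynomial_function (\<lambda>t::real. x + t *\<^sub>R d)"
    by (intro polynomial_function_add polynomial_function_const polynomial_function_bounded_linear
        bounded_linear_scaleR_left)
  then have "real_polynomial_function (f \<circ> (\<lambda>t. x + t *\<^sub>R d))"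
    using f by (rule real_polynomial_function_compose)
  then obtain c n where c: "f \<circ> (\<lambda>t. x + t *\<^sub>R d) = (\<lambda>t. \<Sum>i\<le>n. c i * t ^ i)"
    using real_polynomial_function_imp_sum by blast
  then have eq: "f (x + t *\<^sub>R d) = (\<Sum>i\<le>n. c i * t ^ i)" for t by (metis comp_apply)
  have "\<exists>i\<le>n. c i \<noteq> 0"
  proof (rule ccontr)
    assume "\<not> (\<exists>i\<le>n. c i \<noteq> 0)"
    then have "f (x + t\<^sub>0 *\<^sub>R d) = 0" unfolding eq by simp
    with nz show False ..
  qed
  then show ?thesis unfolding eq using polyfun_rootbound_finite[of n c] by blast
qed

text \<open>
  On the line through a point that is good for the old polynomials and a point that is good for the
  new one, each polynomial has only finitely many zeros.
\<close>

lemma common_nonzero_point: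
  fixes P :: "('a::real_normed_vector \<Rightarrow> real) set"
  assumes "finite P" "\<And>f. f \<in> P \<Longrightarrow> real_polynomial_function f" "\<And>f. f \<in> P \<Longrightarrow> \<exists>x. f x \<noteq> 0"
  shows "\<exists>q. \<forall>f\<in>P. f q \<noteq> 0"
  using assms
proof (induction P rule: finite_induct)
  case (insert f P)
  obtain q where q: "\<forall>g\<in>P. g q \<noteq> 0" using insert by blast
  obtain q' where q': "f q' \<noteq> 0" using insert.prems by blast
  have "finite {t. g (q + t *\<^sub>R (q' - q)) = 0}" if "g \<in> insert f P" for g
  proof (cases "g = f")
    case True
    then show ?thesis using finite_zeros_on_line[of f q 1 "q' - q"] q' insert.prems(1) by simp
  next
    case False
    then show ?thesis using finite_zeros_on_line[of g q 0 "q' - q"] q that insert.prems(1) by simp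
  qed
  then have "finite (\<Union>g\<in>insert f P. {t. g (q + t *\<^sub>R (q' - q)) = 0})"
    using insert.hyps by blast
  then obtain t where "t \<notin> (\<Union>g\<in>insert f P. {t. g (q + t *\<^sub>R (q' - q)) = 0})"
    using ex_new_if_finite[OF infinite_UNIV_char_0] by blast
  then show ?case by blast
qed simp

lemma nonzero_on_segment:
  fixes P :: "('a::real_normed_vector \<Rightarrow> real) set"
  assumes P: "finite P" "\<And>f. f \<in> P \<Longrightarrow> real_polynomial_function f" "\<And>f. f \<in> P \<Longrightarrow> \<exists>x. f x \<noteq> 0"
  obtains d \<epsilon> where "0 < \<epsilon>" "\<And>f t. \<lbrakk>f \<in> P; 0 < t; t < \<epsilon>\<rbrakk> \<Longrightarrow> f (u + t *\<^sub>R d) \<noteq> 0"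
proof -
  obtain q where q: "\<forall>f\<in>P. f q \<noteq> 0" using common_nonzero_point[OF P] by blast
  let ?Z = "\<Union>f\<in>P. {t. f (u + t *\<^sub>R (q - u)) = 0}"
  have "finite ?Z" using finite_zeros_on_line[of _ u 1 "q - u"] q P by auto
  then obtain e where e: "0 < e" "\<And>t. t \<in> ?Z \<Longrightarrow> t \<noteq> 0 \<Longrightarrow> e \<le> dist 0 t"
    using finite_set_avoid[of ?Z 0] by blast
  show ?thesis
  proof (rule that[OF e(1)])
    fix f t assume "f \<in> P" "0 < t" "t < e"
    then show "f (u + t *\<^sub>R (q - u)) \<noteq> 0" using e(2)[of t] by force
  qed
qed


section \<open>Common transversals of three lines\<close>

text \<open>
  The sum vanishes if the images of the lines through \<open>p\<close>, \<open>q\<close>, \<open>r\<close> in the directions \<open>a\<close>, \<open>b\<close>, \<open>c\<close> under the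
  projection along \<open>w\<close> are concurrent: it is the determinant of the three projected lines in
  homogeneous coordinates, expanded along the column of their offsets. As a function of \<open>w\<close> it is
  a quadratic form.
\<close>

definition transversal_form :: "real^3 \<Rightarrow> real^3 \<Rightarrow> real^3 \<Rightarrow> real^3 \<Rightarrow> real^3 \<Rightarrow> real^3 \<Rightarrow> real^3 \<Rightarrow> real" where
  "transversal_form p a q b r c w =
     (cross3 b c \<bullet> w) * (cross3 p a \<bullet> w) + (cross3 c a \<bullet> w) * (cross3 q b \<bullet> w)
       + (cross3 a b \<bullet> w) * (cross3 r c \<bullet> w)"

text \<open>
  If \<open>w\<close> is the direction of a line that meets the first two lines in \<open>x\<close> and \<open>y\<close>, the base points of these two lines
  may be moved to \<open>x\<close>, since moving along \<open>w\<close> is not seen in the projection. The form then says whether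
  this transversal is coplanar with the third line.
\<close>

lemma transversal_form_shift:
  assumes "x = p + s *\<^sub>R a" "y = q + t *\<^sub>R b" "x - y = k *\<^sub>R w"
  shows "transversal_form p a q b r c w = (cross3 a b \<bullet> w) * (cross3 (r - x) c \<bullet> w)"
proof -
  have p: "cross3 p a \<bullet> w = cross3 x a \<bullet> w"
    by (simp add: assms(1) cross_add_left cross_mult_left)
  have y: "y = x - k *\<^sub>R w" using assms(3) by (simp add: algebra_simps)
  have "cross3 q b = cross3 y b" by (simp add: assms(2) cross_add_left cross_mult_left)
  then have q: "cross3 q b \<bullet> w = cross3 x b \<bullet> w"
    by (simp add: y Cross3.left_diff_distrib cross_mult_left inner_diff_left dot_cross_self)
  have "(cross3 b c \<bullet> w) * (cross3 x a \<bullet> w) + (cross3 c a \<bullet> w) * (cross3 x b \<bullet> w)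
       = - ((cross3 a b \<bullet> w) * (cross3 x c \<bullet> w))"
    by (simp add: cross3_def inner_vec_def sum_3 vector_def) algebra
  then show ?thesis
    unfolding transversal_form_def p q
    by (simp add: Cross3.left_diff_distrib inner_diff_left algebra_simps)
qed

lemma transversal_form_eq_0:
  assumes "x = p + s *\<^sub>R a" "y = q + t *\<^sub>R b" "z = r + m *\<^sub>R c" "x - y = k *\<^sub>R w" "x - z = l *\<^sub>R w"
  shows "transversal_form p a q b r c w = 0"
proof -
  have "r - x = - (l *\<^sub>R w) - m *\<^sub>R c" using assms(3,5) by (simp add: algebra_simps)
  then have "cross3 (r - x) c \<bullet> w = 0"
    by (simp add: Cross3.left_diff_distrib cross_mult_left inner_diff_left dot_cross_self)
  then show ?thesis by (simp add: transversal_form_shift[OF assms(1,2,4)])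
qed

text \<open>
  If the form vanished identically, every line that meets the first two lines would be coplanar with
  the third line. For a fixed point on the first line, this puts the second line into the plane
  spanned by that point and the third line. Two points on the first line give two different such planes,
  which meet in the third line only, so the second line would be parallel to it.
\<close>

lemma transversal_form_nontrivial:
  assumes ab: "cross3 a b \<bullet> (q - p) \<noteq> 0" and ac: "cross3 a c \<bullet> (r - p) \<noteq> 0" and bc: "cross3 b c \<noteq> 0"
  shows "\<exists>w. transversal_form p a q b r c w \<noteq> 0"
proof (rule ccontr)
  assume "\<nexists>w. transversal_form p a q b r c w \<noteq> 0"
  then have 0: "transversal_form p a q b r c w = 0" for w by blast
  have *: "cross3 (r - (p + s *\<^sub>R a)) c \<bullet> ((q + t *\<^sub>R b) - (p + s *\<^sub>R a)) = 0" for s t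
  proof -
    let ?w = "(q + t *\<^sub>R b) - (p + s *\<^sub>R a)"
    have "cross3 a b \<bullet> ?w = cross3 a b \<bullet> (q - p)"
      by (simp add: inner_diff_right inner_add_right dot_cross_self)
    then show ?thesis
      using transversal_form_shift[of "p + s *\<^sub>R a" p s a "q + t *\<^sub>R b" q t b "-1" ?w r c] 0[of ?w] ab
      by simp
  qed
  have **: "cross3 (r - (p + s *\<^sub>R a)) c \<bullet> b = 0" for s
    using *[of s 0] *[of s 1] by (simp add: inner_diff_right inner_add_right)
  define m where "m = cross3 (r - p) c"
  define n where "n = cross3 a c"
  have mb: "m \<bullet> b = 0" using **[of 0] by (simp add: m_def)
  have "r - (p + 1 *\<^sub>R a) = (r - p) - a" by simp
  then have nb: "n \<bullet> b = 0"
    using **[of 1] mb by (simp add: m_def n_def Cross3.left_diff_distrib cross_add_left inner_diff_left inner_add_left)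
  have "cross3 m n = (m \<bullet> c) *\<^sub>R a - (m \<bullet> a) *\<^sub>R c" unfolding n_def by (rule Lagrange)
  then have mn: "cross3 m n = (- (m \<bullet> a)) *\<^sub>R c" by (simp add: m_def dot_cross_self)
  have "m \<bullet> a = - (cross3 a c \<bullet> (r - p))"
    unfolding m_def by (simp add: cross3_simps)
  then have ma: "m \<bullet> a \<noteq> 0" using ac by simp
  have "cross3 b (cross3 m n) = 0" using mb nb by (simp add: Lagrange inner_commute)
  then show False using mn ma bc by (simp add: cross_mult_right)
qed


section \<open>Generic directions\<close>

context polygonal_arc
begin

text \<open>
  In this order, they vanish if an edge is parallel to \<open>w\<close>, if a vertex is seen on the line of an edge, if two
  edges are seen as parallel, and if the lines of three edges are seen as concurrent. Some of the
  polynomials are identically zero, for example for a vertex on the edge itself; genericity concerns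
  only those that are not.
\<close>

definition direction_polynomials :: "(real^3 \<Rightarrow> real) set" where
  "direction_polynomials =
     (let I = {i. Suc i < length vs}; K = {..<length vs}; d = edge_dir vs in
       (\<lambda>i w. cross3 (d i) w \<bullet> cross3 (d i) w) ` I \<union>
       (\<lambda>(i, k) w. cross3 (vs ! i - vs ! k) (d i) \<bullet> w) ` (I \<times> K) \<union>
       (\<lambda>(i, j) w. cross3 (d i) (d j) \<bullet> w) ` (I \<times> I) \<union>
       (\<lambda>(i, j, k). transversal_form (vs ! i) (d i) (vs ! j) (d j) (vs ! k) (d k)) ` (I \<times> I \<times> I))"

definition generic :: "real^3 \<Rightarrow> bool" where
  "generic w \<longleftrightarrow> (\<forall>f\<in>direction_polynomials. (\<exists>x. f x \<noteq> 0) \<longrightarrow> f w \<noteq> 0)"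

lemma genericD: "\<lbrakk>generic w; f \<in> direction_polynomials; f x \<noteq> 0\<rbrakk> \<Longrightarrow> f w \<noteq> 0"
  unfolding generic_def by blast

lemma finite_direction_polynomials: "finite direction_polynomials"
  unfolding direction_polynomials_def Let_def
  by (intro finite_UnI finite_imageI finite_cartesian_product finite_lessThan finite_edge_indices)

lemma real_polynomial_direction_polynomials:
  assumes "f \<in> direction_polynomials"
  shows "real_polynomial_function f"
proof -
  have lin: "real_polynomial_function (\<lambda>w. n \<bullet> w)" for n :: "real^3"
    by (intro real_polynomial_function.intros(1) bounded_linear_inner_right)
  have eq: "cross3 n w \<bullet> cross3 n w = (n \<bullet> n) * (w \<bullet> w) - (n \<bullet> w) * (n \<bullet> w)" for n w
    by (simp add: dot_cross inner_commute)
  \<comment> \<open>the square of the norm as a polynomial: products of linear functions are required\<close>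
  have ww: "w \<bullet> w = (w \<bullet> axis 1 1) * (w \<bullet> axis 1 1) + (w \<bullet> axis 2 1) * (w \<bullet> axis 2 1)
      + (w \<bullet> axis 3 1) * (w \<bullet> axis 3 1)" for w :: "real^3"
    by (simp add: inner_vec_def sum_3 axis_def)
  have lin': "real_polynomial_function (\<lambda>w. w \<bullet> n)" for n :: "real^3"
    by (intro real_polynomial_function.intros(1) bounded_linear_inner_left)
  have "real_polynomial_function (\<lambda>w. cross3 n w \<bullet> cross3 n w)" for n
    unfolding eq unfolding ww
    by (intro real_polynomial_function_diff real_polynomial_function.intros(2-4) lin lin')
  moreover have "real_polynomial_function (transversal_form p a q b r c)" for p a q b r c
    unfolding transversal_form_def[abs_def]
    by (intro real_polynomial_function.intros(2-4) lin)
  ultimately show ?thesis using assms lin unfolding direction_polynomials_def Let_def by auto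
qed

lemma generic_edge:
  assumes "generic w" "Suc i < length vs"
  shows "cross3 (edge_dir vs i) w \<noteq> 0"
proof -
  let ?f = "\<lambda>w. cross3 (edge_dir vs i) w \<bullet> cross3 (edge_dir vs i) w"
  have "?f \<in> direction_polynomials" using assms(2) unfolding direction_polynomials_def Let_def by auto
  moreover obtain y where "y \<noteq> 0" "edge_dir vs i \<bullet> y = 0"
    using orthogonal_to_vector_exists[of "edge_dir vs i"] by (auto simp: orthogonal_def)
  then have "?f y \<noteq> 0" using edge_dir_nonzero[OF assms(2)] norm_and_cross_eq_0[of "edge_dir vs i" y] by auto
  ultimately have "?f w \<noteq> 0" by (rule genericD[OF assms(1), of ?f])
  then show ?thesis by auto
qed

lemma generic_vertex_edge:
  assumes "generic w" "Suc i < length vs" "k < length vs" "cross3 (vs ! i - vs ! k) (edge_dir vs i) \<noteq> 0"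
  shows "cross3 (vs ! i - vs ! k) (edge_dir vs i) \<bullet> w \<noteq> 0"
proof -
  let ?f = "\<lambda>w. cross3 (vs ! i - vs ! k) (edge_dir vs i) \<bullet> w"
  have "?f \<in> direction_polynomials"
    using assms(2,3) unfolding direction_polynomials_def Let_def by force
  moreover have "?f (cross3 (vs ! i - vs ! k) (edge_dir vs i)) \<noteq> 0" using assms(4) by simp
  ultimately show ?thesis by (rule genericD[OF assms(1), of ?f])
qed

lemma generic_two_edges:
  assumes "generic w" "Suc i < length vs" "Suc j < length vs" "cross3 (edge_dir vs i) (edge_dir vs j) \<noteq> 0"
  shows "cross3 (edge_dir vs i) (edge_dir vs j) \<bullet> w \<noteq> 0"
proof -
  let ?f = "\<lambda>w. cross3 (edge_dir vs i) (edge_dir vs j) \<bullet> w"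
  have "?f \<in> direction_polynomials"
    using assms(2,3) unfolding direction_polynomials_def Let_def by force
  moreover have "?f (cross3 (edge_dir vs i) (edge_dir vs j)) \<noteq> 0" using assms(4) by simp
  ultimately show ?thesis by (rule genericD[OF assms(1), of ?f])
qed

lemma generic_three_edges:
  assumes "generic w" "Suc i < length vs" "Suc j < length vs" "Suc k < length vs"
    "cross3 (edge_dir vs i) (edge_dir vs j) \<bullet> (vs ! j - vs ! i) \<noteq> 0"
    "cross3 (edge_dir vs i) (edge_dir vs k) \<bullet> (vs ! k - vs ! i) \<noteq> 0"
    "cross3 (edge_dir vs j) (edge_dir vs k) \<noteq> 0"
  shows "transversal_form (vs ! i) (edge_dir vs i) (vs ! j) (edge_dir vs j) (vs ! k) (edge_dir vs k) w \<noteq> 0"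
proof -
  let ?f = "transversal_form (vs ! i) (edge_dir vs i) (vs ! j) (edge_dir vs j) (vs ! k) (edge_dir vs k)"
  have "?f \<in> direction_polynomials"
    using assms(2-4) unfolding direction_polynomials_def Let_def by force
  moreover obtain x where "?f x \<noteq> 0" using transversal_form_nontrivial[OF assms(5-7)] by blast
  ultimately show ?thesis by (rule genericD[OF assms(1), of ?f])
qed

lemma generic_scale:
  assumes "generic w" "c \<noteq> 0"
  shows "generic (c *\<^sub>R w)"
proof -
  have tf: "transversal_form p a q b r d (c *\<^sub>R w) = c * c * transversal_form p a q b r d w" for p a q b r d
    unfolding transversal_form_def by (simp add: algebra_simps)
  have "f (c *\<^sub>R w) = c * c * f w \<or> f (c *\<^sub>R w) = c * f w" if "f \<in> direction_polynomials" for f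
    using that unfolding direction_polynomials_def Let_def
    by (auto simp: cross_mult_right tf)
  then show ?thesis using assms unfolding generic_def by (metis mult_eq_0_iff)
qed

text \<open>
  If the vertex is not collinear with the edge, the plane through both does not contain the direction \<open>w\<close>;
  if it is collinear, \<open>w\<close> would be parallel to the edge.
\<close>

lemma generic_vertex_fibre:
  assumes g: "generic w" and x: "x \<in> support L" and k: "k < length vs" and c: "x - vs ! k = c *\<^sub>R w"
  shows "x = vs ! k"
proof -
  obtain i where i: "Suc i < length vs" "x \<in> edge vs i" using in_supportE[OF x] .
  obtain s where s: "x = vs ! i + s *\<^sub>R edge_dir vs i" using edge_param[OF i(2)] by metis
  have "cross3 (x - vs ! k) (edge_dir vs i) = cross3 (vs ! i - vs ! k) (edge_dir vs i)"
    unfolding s by (simp add: Cross3.left_diff_distrib cross_add_left cross_mult_left)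
  then have n: "cross3 (vs ! i - vs ! k) (edge_dir vs i) = c *\<^sub>R cross3 w (edge_dir vs i)"
    by (simp add: c cross_mult_left)
  then have "cross3 (vs ! i - vs ! k) (edge_dir vs i) \<bullet> w = 0" by (simp add: dot_cross_self)
  then have "c *\<^sub>R cross3 w (edge_dir vs i) = 0" using generic_vertex_edge[OF g i(1) k] n by metis
  moreover have "cross3 w (edge_dir vs i) \<noteq> 0"
    using generic_edge[OF g i(1)] cross_skew[of w "edge_dir vs i"] by simp
  ultimately show ?thesis using c by simp
qed

text \<open>
  Two distinct points with the same image lie on a line parallel to \<open>w\<close>. If their edges were coplanar, this
  line would lie in the common plane, which \<open>w\<close> avoids, or the edges would be collinear and parallel to \<open>w\<close>.
  So the edges are skew.
\<close>

lemma generic_pair: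
  assumes g: "generic w" and ij: "Suc i < length vs" "Suc j < length vs"
    and xy: "x \<in> edge vs i" "y \<in> edge vs j" "x \<noteq> y" and c: "x - y = c *\<^sub>R w"
  shows "cross3 (edge_dir vs i) (edge_dir vs j) \<noteq> 0"
    "cross3 (edge_dir vs i) (edge_dir vs j) \<bullet> (vs ! j - vs ! i) \<noteq> 0"
proof -
  let ?d = "edge_dir vs i" and ?e = "edge_dir vs j"
  have c0: "c \<noteq> 0" using c xy(3) by auto
  obtain s t where st: "x = vs ! i + s *\<^sub>R ?d" "y = vs ! j + t *\<^sub>R ?e" using edge_param xy by metis
  show ne: "cross3 ?d ?e \<noteq> 0"
  proof
    assume "cross3 ?d ?e = 0"
    then have "cross3 ?e ?d = 0" using cross_skew[of ?e ?d] by simp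
    then have "cross3 (x - y) ?d = cross3 (vs ! i - vs ! j) ?d"
      unfolding st by (simp add: Cross3.left_diff_distrib cross_add_left cross_mult_left)
    then have n: "cross3 (vs ! i - vs ! j) ?d = c *\<^sub>R cross3 w ?d" by (simp add: c cross_mult_left)
    then have "cross3 (vs ! i - vs ! j) ?d \<bullet> w = 0" by (simp add: dot_cross_self)
    then have "c *\<^sub>R cross3 w ?d = 0" using generic_vertex_edge[OF g ij(1), of j] ij(2) n by (metis Suc_lessD)
    then show False using c0 generic_edge[OF g ij(1)] cross_skew[of w ?d] by simp
  qed
  have "cross3 ?d ?e \<bullet> (x - y) \<noteq> 0" using generic_two_edges[OF g ij ne] c0 by (simp add: c)
  then show "cross3 ?d ?e \<bullet> (vs ! j - vs ! i) \<noteq> 0"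
    unfolding st by (auto simp: inner_diff_right inner_add_right dot_cross_self)
qed

text \<open>
  At most two edges, with consecutive indices, pass through \<open>x\<close>. If their directions are independent,
  their plane does not contain \<open>w\<close>; otherwise the span is the direction of a single edge.
\<close>

lemma generic_immersion:
  assumes g: "generic w"
  shows "w \<notin> span {edge_dir vs i | i. Suc i < length vs \<and> x \<in> edge vs i}" (is "w \<notin> span ?S")
proof
  assume w: "w \<in> span ?S"
  have "\<exists>i. Suc i < length vs \<and> x \<in> edge vs i"
  proof (rule ccontr)
    assume no: "\<nexists>i. Suc i < length vs \<and> x \<in> edge vs i"
    then have "?S = {}" by auto
    then have "w = 0" using w by (metis span_empty singletonD)
    then show False using generic_edge[OF g, of 0] length_vs by auto
  qed
  then obtain i where i: "Suc i < length vs" "x \<in> edge vs i"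
    and least: "\<And>j. Suc j < length vs \<Longrightarrow> x \<in> edge vs j \<Longrightarrow> i \<le> j"
    using exists_least_iff[of "\<lambda>i. Suc i < length vs \<and> x \<in> edge vs i"] by (metis not_less)
  have j: "j = i \<or> j = Suc i" if "Suc j < length vs" "x \<in> edge vs j" for j
    using least[OF that] arc_polygonal_path_edges_meet[OF arc_vs, of i j x] that i by fastforce
  show False
  proof (cases "\<forall>d \<in> ?S. cross3 (edge_dir vs i) d = 0")
    case True
    have "subspace {v. cross3 (edge_dir vs i) v = 0}"
      by (auto simp: subspace_def cross_add_right cross_mult_right)
    then have "span ?S \<subseteq> {v. cross3 (edge_dir vs i) v = 0}" using True by (intro span_minimal) auto
    then show False using w generic_edge[OF g i(1)] by auto
  next
    case False
    then obtain j' where j': "Suc j' < length vs" "x \<in> edge vs j'" "cross3 (edge_dir vs i) (edge_dir vs j') \<noteq> 0"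
      by blast
    then have "j' = Suc i" using j by (metis cross_refl)
    then have "?S \<subseteq> {edge_dir vs i, edge_dir vs j'}" using j by auto
    also have "\<dots> \<subseteq> {v. cross3 (edge_dir vs i) (edge_dir vs j') \<bullet> v = 0}" by (auto simp: dot_cross_self)
    finally have "span ?S \<subseteq> {v. cross3 (edge_dir vs i) (edge_dir vs j') \<bullet> v = 0}"
      by (intro span_minimal subspace_hyperplane)
    then show False using w generic_two_edges[OF g i(1) j'(1,3)] by auto
  qed
qed

text \<open>
  The edges through two points of the same fibre are skew, so a third point of the fibre would make the
  transversal form of three pairwise skew edges vanish at \<open>w\<close>.
\<close>

lemma generic_imp_regular:
  assumes g: "generic w" and n: "norm w = 1"
  shows "regular w"
proof -
  obtain e1 e2 where f: "positive_frame w e1 e2" using positive_frame_exists[of w] n by auto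
  have diff: "\<exists>c. x - y = c *\<^sub>R w" if "proj w x = proj w y" for x y
  proof -
    have "x - y = (x \<bullet> w - y \<bullet> w) *\<^sub>R w" using that by (simp add: proj_def algebra_simps)
    then show ?thesis ..
  qed
  have vertex: "fibre L w (proj w (vs ! k)) = {vs ! k}" if "k < length vs" for k
    using generic_vertex_fibre[OF g _ that] diff vertex_in_support[OF that] unfolding fibre_def by blast
  have crossing: "crossing_point vs L w p" if p: "p \<in> multiple_points L w" for p
  proof -
    obtain x y where xy: "x \<in> support L" "y \<in> support L" "x \<noteq> y" "proj w x = p" "proj w y = p"
      using p unfolding multiple_points_def fibre_def by blast
    have nv: "z \<noteq> vs ! k" if "k < length vs" "z \<in> {x, y}" for z k
    proof
      assume z: "z = vs ! k"
      then have "{x, y} \<subseteq> fibre L w (proj w (vs ! k))" using xy that unfolding fibre_def by auto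
      then show False using vertex[OF that(1)] xy(3) by auto
    qed
    obtain i where i: "Suc i < length vs" "x \<in> edge vs i" using in_supportE[OF xy(1)] .
    obtain j where j: "Suc j < length vs" "y \<in> edge vs j" using in_supportE[OF xy(2)] .
    obtain c where c: "x - y = c *\<^sub>R w" using diff xy by metis
    note P = generic_pair[OF g i(1) j(1) i(2) j(2) xy(3) c]
    have "z = x \<or> z = y" if z: "z \<in> fibre L w p" for z
    proof (rule ccontr)
      assume ne: "\<not> (z = x \<or> z = y)"
      have zs: "z \<in> support L" "proj w z = p" using z by (auto simp: fibre_def)
      obtain k where k: "Suc k < length vs" "z \<in> edge vs k" using in_supportE[OF zs(1)] .
      obtain c1 where c1: "x - z = c1 *\<^sub>R w" using diff xy zs by metis
      obtain c2 where c2: "y - z = c2 *\<^sub>R w" using diff xy zs by metis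
      have Q: "cross3 (edge_dir vs i) (edge_dir vs k) \<bullet> (vs ! k - vs ! i) \<noteq> 0"
        using generic_pair(2)[OF g i(1) k(1) i(2) k(2) _ c1] ne by auto
      have R: "cross3 (edge_dir vs j) (edge_dir vs k) \<noteq> 0"
        using generic_pair(1)[OF g j(1) k(1) j(2) k(2) _ c2] ne by auto
      obtain s where s: "x = vs ! i + s *\<^sub>R edge_dir vs i" using edge_param[OF i(2)] by metis
      obtain t where t: "y = vs ! j + t *\<^sub>R edge_dir vs j" using edge_param[OF j(2)] by metis
      obtain r where r: "z = vs ! k + r *\<^sub>R edge_dir vs k" using edge_param[OF k(2)] by metis
      show False
        using generic_three_edges[OF g i(1) j(1) k(1) P(2) Q R] transversal_form_eq_0[OF s t r c c1] by simp
    qed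
    then have fib: "fibre L w p = {x, y}" using xy unfolding fibre_def by blast
    have "x \<in> open_segment (vs ! i) (vs ! Suc i)" "y \<in> open_segment (vs ! j) (vs ! Suc j)"
      using i j nv[of i x] nv[of "Suc i" x] nv[of j y] nv[of "Suc j" y]
      by (auto simp: open_segment_def edge_def)
    moreover have "\<not> collinear {0, proj w (vs ! Suc i - vs ! i), proj w (vs ! Suc j - vs ! j)}"
      unfolding collinear_projections_iff[OF f]
      using generic_two_edges[OF g i(1) j(1) P(1)] by (simp add: edge_dir_def)
    ultimately show ?thesis unfolding crossing_point_def using i(1) j(1) xy(3) fib by blast
  qed
  show ?thesis unfolding regular_def using vertex crossing generic_immersion[OF g] by blast
qed


section \<open>The stable class of approximations\<close>

lemma regular_projection_in_arc_diagrams: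
  assumes "regular v" "norm v = 1"
  shows "projection_image L v \<in> arc_diagrams"
proof -
  have "spatial_arc L" using vertices unfolding spatial_arc_def by blast
  then show ?thesis unfolding arc_diagrams_def using regular_projects_to_diagram[OF assms(1)] assms(2) by auto
qed

text \<open>
  Stability says that the isomorphism class is locally constant, and this is enough on a connected set.
\<close>

lemma isomorphic_on_connected:
  assumes S: "connected S" "\<And>v. v \<in> S \<Longrightarrow> regular v \<and> norm v = 1" and v: "v \<in> S" "v' \<in> S"
  shows "(projection_image L v, projection_image L v') \<in> isomorphic_diagrams"
proof (rule connected_equivalence_relation[OF S(1) v])
  have eq: "equiv arc_diagrams isomorphic_diagrams" by (rule equiv_isomorphic_diagrams)
  show "(projection_image L y, projection_image L x) \<in> isomorphic_diagrams"
    if "(projection_image L x, projection_image L y) \<in> isomorphic_diagrams" for x y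
    using eq that by (auto simp: equiv_def dest: symD)
  show "(projection_image L x, projection_image L z) \<in> isomorphic_diagrams"
    if "(projection_image L x, projection_image L y) \<in> isomorphic_diagrams"
      "(projection_image L y, projection_image L z) \<in> isomorphic_diagrams" for x y z
    using eq that by (auto simp: equiv_def dest: transD)
  fix a assume a: "a \<in> S"
  have D: "projection_image L x \<in> arc_diagrams" if "x \<in> S" for x
    using regular_projection_in_arc_diagrams S(2) that by blast
  obtain e where e: "0 < e" "\<And>x. \<lbrakk>x \<in> sphere 0 1; x \<noteq> a; dist x a < e; regular x\<rbrakk> \<Longrightarrow>
      \<exists>f. diagram_isomorphism (projection_image L a) (projection_image L x) f"
    using eventually_isomorphic[of a] S(2)[OF a] unfolding eventually_at by blast
  have "(projection_image L a, projection_image L x) \<in> isomorphic_diagrams" if x: "x \<in> S \<inter> ball a e" for x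
  proof (cases "x = a")
    case True
    then show ?thesis using D[OF a] diagram_isomorphism_id by (auto simp: isomorphic_diagrams_def)
  next
    case False
    then show ?thesis using e(2)[of x] x S(2)[of x] D[OF a] D[of x]
      by (auto simp: isomorphic_diagrams_def dist_commute)
  qed
  then show "\<exists>T. openin (top_of_set S) T \<and> a \<in> T \<and> (\<forall>x\<in>T. (projection_image L a, projection_image L x) \<in> isomorphic_diagrams)"
    using a e(1) by (intro exI[of _ "S \<inter> ball a e"]) auto
qed

text \<open>
  The normalised directions along a short segment that starts at \<open>u\<close>. The starting point is left out
  because \<open>u\<close> need not be regular.
\<close>

lemma stable_approximations:
  assumes u: "norm u = 1"
  shows "\<exists>S. u \<in> closure S \<and> connected S \<and> (\<forall>v\<in>S. regular v \<and> norm v = 1)"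
proof -
  let ?P = "{f \<in> direction_polynomials. \<exists>x. f x \<noteq> 0}"
  obtain d \<epsilon> where \<epsilon>: "0 < \<epsilon>" "\<And>f t. \<lbrakk>f \<in> ?P; 0 < t; t < \<epsilon>\<rbrakk> \<Longrightarrow> f (u + t *\<^sub>R d) \<noteq> 0"
    by (rule nonzero_on_segment[of ?P u])
      (use finite_direction_polynomials real_polynomial_direction_polynomials in auto)
  define w where "w t = u + t *\<^sub>R d" for t
  have gen: "generic (w t)" if "0 < t" "t < \<epsilon>" for t
    using \<epsilon>(2) that unfolding generic_def w_def by blast
  have nz: "w t \<noteq> 0" if "0 < t" "t < \<epsilon>" for t
    using generic_edge[OF gen[OF that], of 0] length_vs by auto
  define v where "v t = w t /\<^sub>R norm (w t)" for t
  have "regular (v t)" "norm (v t) = 1" if "0 < t" "t < \<epsilon>" for t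
  proof -
    show "norm (v t) = 1" using nz[OF that] by (simp add: v_def)
    then show "regular (v t)"
      using generic_imp_regular generic_scale[OF gen[OF that]] nz[OF that] by (simp add: v_def)
  qed
  then have reg: "\<forall>x \<in> v ` {0<..<\<epsilon>}. regular x \<and> norm x = 1" by auto
  have "continuous_on {0<..<\<epsilon>} v"
    unfolding v_def w_def using nz unfolding w_def by (intro continuous_intros) auto
  then have conn: "connected (v ` {0<..<\<epsilon>})" by (rule connected_continuous_image) simp
  have "isCont v 0" unfolding v_def w_def using u by (intro continuous_intros) auto
  moreover have v0: "v 0 = u" using u by (simp add: v_def w_def)
  ultimately have lim: "(v \<longlongrightarrow> u) (at_right 0)"
    unfolding isCont_def by (auto intro: filterlim_mono at_le)
  have "u \<in> closure (v ` {0<..<\<epsilon>})"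
  proof (rule Lim_in_closed_set[OF closed_closure _ _ lim])
    have "\<forall>\<^sub>F t in at_right 0. t \<in> {0<..<\<epsilon>}" using \<epsilon>(1) by (rule eventually_at_right_real)
    then show "\<forall>\<^sub>F t in at_right 0. v t \<in> closure (v ` {0<..<\<epsilon>})"
      by eventually_elim (rule subsetD[OF closure_subset imageI])
  qed simp
  then show ?thesis using conn reg by blast
qed

end

theorem theorem1p1:
  shows "\<exists>D :: oriented_arc \<Rightarrow> real^3 \<Rightarrow> arc_diagram set.
    \<forall>L u. spatial_arc L \<and> u \<in> sphere 0 1 \<longrightarrow>
      D L u \<in> arc_diagrams // isomorphic_diagrams \<and>
      (\<exists>\<delta>\<^sub>0>0. \<exists>v :: real \<Rightarrow> real^3.
         (\<forall>\<delta>. 0 < \<delta> \<and> \<delta> < \<delta>\<^sub>0 \<longrightarrow>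
            delta_approximation \<delta> u (v \<delta>) \<and>
            projects_to_diagram L (v \<delta>) \<and>
            projection_image L (v \<delta>) \<in> D L u) \<and>
         (\<forall>\<delta> \<delta>'. 0 < \<delta> \<and> \<delta> < \<delta>\<^sub>0 \<and> 0 < \<delta>' \<and> \<delta>' < \<delta>\<^sub>0 \<longrightarrow>
            (projection_image L (v \<delta>), projection_image L (v \<delta>')) \<in> isomorphic_diagrams))"
proof (intro choice allI)
  fix L :: oriented_arc and u :: "real^3"
  show "\<exists>X. spatial_arc L \<and> u \<in> sphere 0 1 \<longrightarrow>
      X \<in> arc_diagrams // isomorphic_diagrams \<and>
      (\<exists>\<delta>\<^sub>0>0. \<exists>v :: real \<Rightarrow> real^3.
         (\<forall>\<delta>. 0 < \<delta> \<and> \<delta> < \<delta>\<^sub>0 \<longrightarrow>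
            delta_approximation \<delta> u (v \<delta>) \<and>
            projects_to_diagram L (v \<delta>) \<and>
            projection_image L (v \<delta>) \<in> X) \<and>
         (\<forall>\<delta> \<delta>'. 0 < \<delta> \<and> \<delta> < \<delta>\<^sub>0 \<and> 0 < \<delta>' \<and> \<delta>' < \<delta>\<^sub>0 \<longrightarrow>
            (projection_image L (v \<delta>), projection_image L (v \<delta>')) \<in> isomorphic_diagrams))"
  proof (cases "spatial_arc L \<and> u \<in> sphere 0 1")
    case True
    then obtain vs where "vertex_list_of vs L" unfolding spatial_arc_def by blast
    then interpret polygonal_arc vs L by unfold_locales
    obtain S where S: "u \<in> closure S" "connected S" "\<And>v. v \<in> S \<Longrightarrow> regular v \<and> norm v = 1"
      using stable_approximations[of u] True by auto
    note iso = isomorphic_on_connected[OF S(2,3)]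
    have "\<exists>v\<in>S. dist v u < \<delta>" if "0 < \<delta>" for \<delta>
      using S(1) that by (auto simp: closure_approachable)
    then obtain v where v: "\<And>\<delta>. 0 < \<delta> \<Longrightarrow> v \<delta> \<in> S \<and> dist (v \<delta>) u < \<delta>" by metis
    \<comment> \<open>all values of \<open>v\<close> lie in \<open>S\<close>, so any of them represents the class\<close>
    let ?X = "isomorphic_diagrams `` {projection_image L (v 1)}"
    have "?X \<in> arc_diagrams // isomorphic_diagrams"
      using v[of 1] S(3)[of "v 1"] by (intro quotientI regular_projection_in_arc_diagrams) auto
    moreover have "delta_approximation \<delta> u (v \<delta>)" "projects_to_diagram L (v \<delta>)" "projection_image L (v \<delta>) \<in> ?X"
      if "0 < \<delta>" for \<delta>
      using v[OF that] S(3)[of "v \<delta>"] iso[of "v 1" "v \<delta>"] v[of 1] regular_projects_to_diagram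
      by (auto simp: delta_approximation_def dist_norm)
    moreover have "(projection_image L (v \<delta>), projection_image L (v \<delta>')) \<in> isomorphic_diagrams"
      if "0 < \<delta>" "0 < \<delta>'" for \<delta> \<delta>'
      using iso v that by blast
    ultimately show ?thesis by (intro exI[of _ ?X] impI conjI exI[of _ "1::real"] exI[of _ v]) auto
  qed blast
qed

end
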